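(* For every graph $\mathcal{G}$ with vertex set $\{1,\dots,p\}$, both $\rho(\mathcal{G}) \leq \ell(\mathcal{G}) \leq \delta(\mathcal{G})+1$ and $\rho^*(\mathcal{G}) \leq \delta(\mathcal{G})+1$.
   Context: Graphs are finite, simple and undirected, $\mathcal{G}=(V,E)$ with $V=\{1,\dots,p\}$, $p\ge 1$, and $E\subseteq\{\{i,j\}: i,j\in V,\ i\neq j\}$. $\mathcal{S}$ is the space of real symmetric $p\times p$ matrices. $\mathcal{S}_{\mathcal{G}}=\{\Omega\in\mathcal{S}: \Omega_{ij}=0 \text{ for all } i\neq j \text{ with } \{i,j\}\notin E\}$ (diagonal entries are unconstrained). $\mathcal{D}_{\mathcal{G}}^{++}=\{\Omega\in\mathcal{S}_{\mathcal{G}}:\Omega_{ii}>0\ \forall i\}$. For a positive semidefinite $A\in\mathcal{S}$ and $\Omega\in\mathcal{D}_{\mathcal{G}}^{++}$ with columns $\Omega_{\cdot 1},\dots,\Omega_{\cdot p}$, the CONCORD objective is $C_A(\Omega)=-2\sum_{i=1}^p\log\Omega_{ii}+\sum_{i=1}^p\Omega_{\cdot i}^{\top}A\,\Omega_{\cdot i}$, and the CONSPACE objective is $H_A(\Omega)=-2\sum_{i=1}^p\log\Omega_{ii}+\sum_{i=1}^p\Omega_{ii}^{-1}\Omega_{\cdot i}^{\top}A\,\Omega_{\cdot i}$. A symmetric matrix $A$ is in general position if every $q\times q$ principal submatrix of $A$ has rank $\min\{q,\operatorname{rank}(A)\}$. "For almost every $A\succeq 0$ with $\operatorname{rank}(A)\ge\rho$"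 means: for each integer $r$ with $\rho\le r\le p$, the property holds for $A=X^\top X$ for Lebesgue-almost every $X\in\mathbb{R}^{r\times p}$. Weak pseudo-likelihood rank $\rho(\mathcal{G})$: the smallest $\rho\in\mathbb{N}$ such that a unique minimizer of $C_A$ exists on $\mathcal{D}_{\mathcal{G}}^{++}$ for almost every $A\succeq 0$ with $\operatorname{rank}(A)\ge\rho$. Strong pseudo-likelihood rank $\rho^*(\mathcal{G})$: the smallest $\rho^*\in\mathbb{N}$ such that a unique minimizer of $C_A$ exists on $\mathcal{D}_{\mathcal{G}}^{++}$ for every $A\succeq0$ in general position with $\operatorname{rank}(A)\ge\rho^*$. (Using $H_A$ in place of $C_A$ gives the same numbers.) Graph degeneracy $\delta(\mathcal{G})$: the smallest $\delta\in\mathbb{N}=\{0,1,2,\dots\}$ such that every nonempty subgraph of $\mathcal{G}$ contains a vertex whose degree in that subgraph is at most $\delta$. Generic completion rank $\ell(\mathcal{G})$: the smallest $\ell\in\mathbb{N}$ such that the image of $\{\Omega\in\mathcal{S}:\operatorname{rank}(\Omega)=\ell\}$ under the orthogonal (coordinate) projection $\mathcal{S}\to\mathcal{S}_{\mathcal{G}}$ (setting to zero the entries $\Omega_{ij}$ with $i\ne j$, $\{i,j\}\notin E$) is Zariski-dense in $\mathcal{S}_{\mathcal{G}}$, i.e. no nonzero polynomial on $\mathcal{S}_{\mathcal{G}}$ vanishes on it. *)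

theory Defs
  imports "HOL-Analysis.Analysis"
begin

text \<open>
  The vertex set is an arbitrary (finite, nonempty) index type \<open>'n\<close>, so that \<open>p = CARD('n)\<close>,
  and a graph is given by its set of edges, each edge being a two-element set of vertices.
\<close>

definition simple_graph :: "'n::finite set set \<Rightarrow> bool" where
  "simple_graph E \<longleftrightarrow> E \<subseteq> {{i, j} | i j. i \<noteq> j}"

subsection \<open>Matrices associated with a graph\<close>

definition symmetric_matrices :: "(real^'n^'n) set" where
  "symmetric_matrices = {\<Omega>. transpose \<Omega> = \<Omega>}"

definition graph_matrices :: "'n::finite set set \<Rightarrow> (real^'n^'n) set" where
  "graph_matrices E =
     {\<Omega> \<in> symmetric_matrices. \<forall>i j. i \<noteq> j \<and> {i, j} \<notin> E \<longrightarrow> \<Omega> $ i $ j = 0}"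

definition posdiag_graph_matrices :: "'n::finite set set \<Rightarrow> (real^'n^'n) set" where
  "posdiag_graph_matrices E = {\<Omega> \<in> graph_matrices E. \<forall>i. \<Omega> $ i $ i > 0}"

definition graph_projection :: "'n::finite set set \<Rightarrow> real^'n^'n \<Rightarrow> real^'n^'n" where
  "graph_projection E \<Omega> = (\<chi> i j. if i \<noteq> j \<and> {i, j} \<notin> E then 0 else \<Omega> $ i $ j)"

definition pos_semidef :: "real^'n^'n \<Rightarrow> bool" where
  "pos_semidef A \<longleftrightarrow> A \<in> symmetric_matrices \<and> (\<forall>x. x \<bullet> (A *v x) \<ge> 0)"

text \<open>
  Submatrices of varying size do not live in a common type.  The principal submatrix with index
  set \<open>S\<close> is therefore padded with zero rows and zero columns, which does not change its rank.
\<close>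

definition principal_submatrix :: "'n set \<Rightarrow> real^'n^'n \<Rightarrow> real^'n^'n" where
  "principal_submatrix S A = (\<chi> i j. if i \<in> S \<and> j \<in> S then A $ i $ j else 0)"

definition general_position :: "real^'n^'n \<Rightarrow> bool" where
  "general_position A \<longleftrightarrow>
     A \<in> symmetric_matrices \<and>
     (\<forall>S. rank (principal_submatrix S A) = min (card S) (rank A))"

subsection \<open>Pseudo-likelihood ranks\<close>

definition concord :: "real^'n^'n \<Rightarrow> real^'n^'n \<Rightarrow> real" where
  "concord A \<Omega> =
     - 2 * (\<Sum>i\<in>UNIV. ln (\<Omega> $ i $ i)) + (\<Sum>i\<in>UNIV. column i \<Omega> \<bullet> (A *v column i \<Omega>))"

definition unique_minimizer :: "'n::finite set set \<Rightarrow> real^'n^'n \<Rightarrow> bool" where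
  "unique_minimizer E A \<longleftrightarrow>
     (\<exists>!\<Omega>. is_arg_min (concord A) (\<lambda>\<Omega>. \<Omega> \<in> posdiag_graph_matrices E) \<Omega>)"

text \<open>
  Since the number \<open>r\<close> of rows is quantified over, an \<open>r \<times> p\<close> matrix \<open>X\<close> is a function on the
  index pairs \<open>{..<r} \<times> UNIV\<close>, and Lebesgue measure is the product measure over these pairs.
  For \<open>r = 0\<close> this is the unit mass on the single empty matrix.
\<close>

definition lebesgue_rows :: "nat \<Rightarrow> (nat \<times> 'n::finite \<Rightarrow> real) measure" where
  "lebesgue_rows r = Pi\<^sub>M ({..<r} \<times> UNIV) (\<lambda>_. lborel)"

text \<open>The matrix \<open>X\<^sup>T X\<close>.\<close>

definition gram :: "nat \<Rightarrow> (nat \<times> 'n::finite \<Rightarrow> real) \<Rightarrow> real^'n^'n" where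
  "gram r X = (\<chi> i j. \<Sum>k<r. X (k, i) * X (k, j))"

definition weak_pl_rank :: "'n::finite set set \<Rightarrow> nat" where
  "weak_pl_rank E =
     (LEAST \<rho>. \<forall>r. \<rho> \<le> r \<and> r \<le> CARD('n) \<longrightarrow>
        (AE X in lebesgue_rows r. unique_minimizer E (gram r X)))"

definition strong_pl_rank :: "'n::finite set set \<Rightarrow> nat" where
  "strong_pl_rank E =
     (LEAST \<rho>. \<forall>A. pos_semidef A \<and> general_position A \<and> \<rho> \<le> rank A \<longrightarrow> unique_minimizer E A)"

subsection \<open>Degeneracy and generic completion rank\<close>

text \<open>A subgraph has vertices \<open>W\<close> and edges \<open>F\<close>; it need not be induced.\<close>

definition degeneracy :: "'n::finite set set \<Rightarrow> nat" where
  "degeneracy E =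
     (LEAST d. \<forall>W F. W \<noteq> {} \<and> F \<subseteq> E \<and> \<Union>F \<subseteq> W \<longrightarrow> (\<exists>v\<in>W. card {e \<in> F. v \<in> e} \<le> d))"

text \<open>
  For a linear subspace \<open>S\<close>, the polynomials on \<open>S\<close> are the restrictions to \<open>S\<close> of polynomial
  functions on the ambient space; over the reals such a polynomial is zero iff it vanishes as a
  function on \<open>S\<close>.
\<close>

definition zariski_dense_in :: "'a::real_normed_vector set \<Rightarrow> 'a set \<Rightarrow> bool" where
  "zariski_dense_in T S \<longleftrightarrow>
     T \<subseteq> S \<and>
     (\<forall>f. real_polynomial_function f \<and> (\<forall>x\<in>T. f x = 0) \<longrightarrow> (\<forall>x\<in>S. f x = 0))"

definition generic_completion_rank :: "'n::finite set set \<Rightarrow> nat" where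
  "generic_completion_rank E =
     (LEAST l. zariski_dense_in
        (graph_projection E ` {\<Omega> \<in> symmetric_matrices. rank \<Omega> = l}) (graph_matrices E))"

end

theory Submission
  imports Defs
begin

text \<open>
  The objective for \<open>A\<close> has a unique minimizer as soon as \<open>\<Omega> \<mapsto> A ** \<Omega>\<close> is injective on
  \<open>graph_matrices E\<close>, since the quadratic part is then positive definite there.

  Every nonzero \<open>\<Omega>\<close> has a nonzero column with at most \<open>degeneracy E + 1\<close> nonzero entries, so
  matrices in general position of rank at least \<open>degeneracy E + 1\<close> are injective in this sense.

  The tangent space at \<open>X\<^sup>T X\<close> of the symmetric matrices of given rank consists of the
  \<open>X\<^sup>T Y + Y\<^sup>T X\<close>; by duality its projection is all of \<open>graph_matrices E\<close> iff \<open>X\<close> is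
  injective.  Hence an injective \<open>X\<close> makes the projection Zariski dense, which applies to points on
  the moment curve.  Conversely, if no \<open>X\<close> is injective, then the parametrization of the projection
  has nowhere full rank, and its components are algebraically dependent.  Finally, injectivity is
  the nonvanishing of a polynomial, so it holds for almost every \<open>X\<close> if it holds for one.
\<close>

subsection \<open>Polynomial functions on Euclidean spaces\<close>

text \<open>Two obstacles shape the argument. The completion rank asks for rank exactly
  \<open>l\<close>, so a Gram matrix near the chosen one must keep its rank; this is why
  independence of the rows is carried along beside injectivity on \<open>graph_matrices E\<close>.
  And density is tested by polynomials, so a derivative of deficient rank must produce a polynomial
  relation; an image of measure zero would not do. Counting gives such a relation only along an
  affine space of dimension below that of \<open>graph_matrices E\<close>. It is spread to the whole
  parameter space by following kernels of the derivative.

  Both implications between density and injectivity rest on one limit argument: a polynomial that is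
  not identically zero has a nonzero term of lowest order at any chosen point, and a curve through
  that point whose direction merely converges already tests this term.

  The weak rank quantifies over all \<open>r\<close> from \<open>l\<close> on. An injective matrix
  with \<open>l\<close> rows is padded with zero rows, which leaves its Gram matrix
  unchanged.\<close>

text \<open>Dividing the sum by \<open>t ^ s\<close> leaves \<open>H s (z t)\<close> plus terms that
  tend to 0. The argument \<open>z t\<close> may move with \<open>t\<close>, so vanishing along a
  curve can be exploited and not only vanishing along a line.\<close>

lemma leading_coefficient_limit:
  fixes H :: "nat \<Rightarrow> 'a::real_normed_vector \<Rightarrow> real"
  assumes cont: "\<And>j. isCont (H j) z0"
    and z: "(z \<longlongrightarrow> z0) (at (0::real))"
    and zero: "\<forall>\<^sub>F t in at 0. (\<Sum>j\<le>n. t ^ j * H j (z t)) = 0"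
    and low: "\<And>j t. j < s \<Longrightarrow> H j (z t) = 0"
    and "s \<le> n"
  shows "H s z0 = 0"
proof -
  define h where "h t = (\<Sum>j\<in>{s..n}. t ^ (j - s) * H j (z t))" for t :: real
  have "(h \<longlongrightarrow> (\<Sum>j\<in>{s..n}. 0 ^ (j - s) * H j z0)) (at 0)"
    unfolding h_def by (intro tendsto_intros isCont_tendsto_compose[OF cont z])
  moreover have "(\<Sum>j\<in>{s..n}. 0 ^ (j - s) * H j z0) = H s z0"
  proof -
    have "(\<Sum>j\<in>{s..n}. 0 ^ (j - s) * H j z0) = (\<Sum>j\<in>{s..n}. if j = s then H s z0 else 0)"
      by (intro sum.cong) auto
    then show ?thesis
      using \<open>s \<le> n\<close> by simp
  qed
  moreover have "\<forall>\<^sub>F t in at 0. h t = 0"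
    using zero eventually_neq_at_within[of 0 0 UNIV]
  proof eventually_elim
    case (elim t)
    have "(\<Sum>j\<le>n. t ^ j * H j (z t)) = (\<Sum>j\<in>{s..n}. t ^ j * H j (z t))"
      by (intro sum.mono_neutral_right) (auto simp: low)
    also have "\<dots> = t ^ s * h t"
      unfolding h_def sum_distrib_left
      by (intro sum.cong) (auto simp: mult.assoc[symmetric] power_add[symmetric])
    finally show ?case
      using elim by auto
  qed
  ultimately have "(h \<longlongrightarrow> H s z0) (at 0)" "(h \<longlongrightarrow> 0) (at 0)"
    by (simp_all add: tendsto_eventually)
  then show ?thesis
    using tendsto_unique[of "at (0::real)"] by force
qed

text \<open>Taylor expansion at the fixed point \<open>x\<close>, with \<open>G j\<close> collecting
  the part of order \<open>j\<close> in the direction \<open>u\<close>. Vanishing of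
  \<open>G j\<close> beyond \<open>n\<close> lets sums be padded to a common bound and places the
  lowest nonzero order below \<open>n\<close>.\<close>

lemma real_polynomial_function_expand:
  fixes g :: "'a::real_normed_vector \<Rightarrow> real"
  assumes "real_polynomial_function g"
  shows "\<exists>n G. (\<forall>j. real_polynomial_function (G j)) \<and> (\<forall>j u. j > n \<longrightarrow> G j u = 0) \<and>
           (\<forall>t u. g (x + t *\<^sub>R u) = (\<Sum>j\<le>n. t ^ j * G j u))"
  using assms
proof (induction g rule: real_polynomial_function.induct)
  case (linear f)
  then interpret bounded_linear f .
  define G where "G j u = (if j = 0 then f x else if j = 1 then f u else 0)" for j :: nat and u
  have "real_polynomial_function (G j)" for j
    using real_polynomial_function.intros(1)[OF bounded_linear_axioms]
      real_polynomial_function.intros(2) unfolding G_def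
    by (cases "j = 0"; cases "j = 1") auto
  moreover have "f (x + t *\<^sub>R u) = (\<Sum>j\<le>1. t ^ j * G j u)" for t u
    by (simp add: G_def add scaleR)
  moreover have "G j u = 0" if "j > 1" for j u
    using that by (simp add: G_def)
  ultimately show ?case
    by blast
next
  case (const c)
  show ?case
    by (intro exI[of _ 0] exI[of _ "\<lambda>j u. if j = 0 then c else 0"]) (auto simp: real_polynomial_function.intros(2))
next
  case (add f g)
  obtain n F where
    F: "\<And>j. real_polynomial_function (F j)" "\<And>j u. j > n \<Longrightarrow> F j u = 0"
      "\<And>t u. f (x + t *\<^sub>R u) = (\<Sum>j\<le>n. t ^ j * F j u)"
    using add.IH(1) by blast
  obtain m G where
    G: "\<And>j. real_polynomial_function (G j)" "\<And>j u. j > m \<Longrightarrow> G j u = 0"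
      "\<And>t u. g (x + t *\<^sub>R u) = (\<Sum>j\<le>m. t ^ j * G j u)"
    using add.IH(2) by blast
  have "(\<Sum>j\<le>n. t ^ j * F j u) = (\<Sum>j\<le>max n m. t ^ j * F j u)"
    "(\<Sum>j\<le>m. t ^ j * G j u) = (\<Sum>j\<le>max n m. t ^ j * G j u)" for t u
    by (intro sum.mono_neutral_left; auto simp: F G)+
  then show ?case
    using F G
    by (intro exI[of _ "max n m"] exI[of _ "\<lambda>j u. F j u + G j u"])
       (auto simp: algebra_simps sum.distrib)
next
  case (mult f g)
  obtain n F where
    F: "\<And>j. real_polynomial_function (F j)" "\<And>j u. j > n \<Longrightarrow> F j u = 0"
      "\<And>t u. f (x + t *\<^sub>R u) = (\<Sum>j\<le>n. t ^ j * F j u)"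
    using mult.IH(1) by blast
  obtain m G where
    G: "\<And>j. real_polynomial_function (G j)" "\<And>j u. j > m \<Longrightarrow> G j u = 0"
      "\<And>t u. g (x + t *\<^sub>R u) = (\<Sum>j\<le>m. t ^ j * G j u)"
    using mult.IH(2) by blast
  have "f (x + t *\<^sub>R u) * g (x + t *\<^sub>R u) =
      (\<Sum>r\<le>n + m. t ^ r * (\<Sum>k\<le>r. F k u * G (r - k) u))" for t u
    using polynomial_product[of n "\<lambda>j. F j u" m "\<lambda>j. G j u" t] F(2) G(2)
    by (simp add: F(3) G(3) mult.commute)
  moreover have "(\<Sum>k\<le>r. F k u * G (r - k) u) = 0" if "r > n + m" for r u
  proof (intro sum.neutral ballI)
    fix k assume "k \<in> {..r}"
    with that have "k > n \<or> r - k > m" by auto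
    then show "F k u * G (r - k) u = 0"
      using F(2) G(2) by auto
  qed
  ultimately show ?case
    using F(1) G(1)
    by (intro exI[of _ "n + m"] exI[of _ "\<lambda>r u. \<Sum>k\<le>r. F k u * G (r - k) u"])
       (auto intro!: real_polynomial_function_sum real_polynomial_function.intros(4))
qed

section \<open>Degree along lines, vanishing on grids, and counting\<close>

text \<open>Stands in for the total degree without a representation by coefficients: it adds up
  under products, and it bounds the number of roots in each coordinate direction.\<close>

definition degree_on_lines_le :: "nat \<Rightarrow> ('a::real_vector \<Rightarrow> real) \<Rightarrow> bool" where
  "degree_on_lines_le N g \<longleftrightarrow> (\<forall>x v. \<exists>p. degree p \<le> N \<and> (\<forall>t. g (x + t *\<^sub>R v) = poly p t))"

lemma degree_on_lines_le_const: "degree_on_lines_le N (\<lambda>x. c)"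
  unfolding degree_on_lines_le_def by (intro allI exI[of _ "[:c:]"]) auto

lemma degree_on_lines_le_mono:
  "degree_on_lines_le N g \<Longrightarrow> N \<le> M \<Longrightarrow> degree_on_lines_le M g"
  unfolding degree_on_lines_le_def by (meson le_trans)

lemma degree_on_lines_le_add:
  assumes "degree_on_lines_le N f" "degree_on_lines_le N g"
  shows "degree_on_lines_le N (\<lambda>x. f x + g x)"
  unfolding degree_on_lines_le_def
proof (intro allI)
  fix x v
  obtain p q where "degree p \<le> N" "\<And>t. f (x + t *\<^sub>R v) = poly p t"
    "degree q \<le> N" "\<And>t. g (x + t *\<^sub>R v) = poly q t"
    using assms unfolding degree_on_lines_le_def by metis
  then show "\<exists>p. degree p \<le> N \<and> (\<forall>t. f (x + t *\<^sub>R v) + g (x + t *\<^sub>R v) = poly p t)"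
    by (intro exI[of _ "p + q"]) (auto simp: degree_add_le)
qed

lemma degree_on_lines_le_mult:
  assumes "degree_on_lines_le N f" "degree_on_lines_le M g"
  shows "degree_on_lines_le (N + M) (\<lambda>x. f x * g x)"
  unfolding degree_on_lines_le_def
proof (intro allI)
  fix x v
  obtain p q where "degree p \<le> N" "\<And>t. f (x + t *\<^sub>R v) = poly p t"
    "degree q \<le> M" "\<And>t. g (x + t *\<^sub>R v) = poly q t"
    using assms unfolding degree_on_lines_le_def by metis
  then show "\<exists>p. degree p \<le> N + M \<and> (\<forall>t. f (x + t *\<^sub>R v) * g (x + t *\<^sub>R v) = poly p t)"
    by (intro exI[of _ "p * q"]) (use degree_mult_le[of p q] in auto)
qed

lemma degree_on_lines_le_sum:
  assumes "finite I" "\<And>i. i \<in> I \<Longrightarrow> degree_on_lines_le N (f i)"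
  shows "degree_on_lines_le N (\<lambda>x. \<Sum>i\<in>I. f i x)"
  using assms
  by (induction I rule: finite_induct) (auto simp: degree_on_lines_le_const degree_on_lines_le_add)

lemma degree_on_lines_le_prod:
  assumes "finite I" "\<And>i. i \<in> I \<Longrightarrow> degree_on_lines_le N (f i)"
  shows "degree_on_lines_le (card I * N) (\<lambda>x. \<Prod>i\<in>I. f i x)"
  using assms
proof (induction I rule: finite_induct)
  case empty
  then show ?case by (simp add: degree_on_lines_le_const)
next
  case (insert i I)
  then show ?case
    using degree_on_lines_le_mult[of N "f i" "card I * N" "\<lambda>x. \<Prod>i\<in>I. f i x"] by simp
qed

lemma real_polynomial_function_degree_on_lines:
  assumes "real_polynomial_function g"
  shows "\<exists>N. degree_on_lines_le N g"
  using assms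
proof (induction g rule: real_polynomial_function.induct)
  case (linear f)
  then interpret bounded_linear f .
  have "degree_on_lines_le 1 f"
    unfolding degree_on_lines_le_def
    by (intro allI exI[of _ "[:f _, f _:]"]) (auto simp: add scaleR)
  then show ?case by blast
next
  case (const c)
  then show ?case using degree_on_lines_le_const by blast
next
  case (add f g)
  then show ?case
    by (metis degree_on_lines_le_add degree_on_lines_le_mono max.cobounded1 max.cobounded2)
next
  case (mult f g)
  then show ?case using degree_on_lines_le_mult by blast
qed

text \<open>A univariate polynomial of degree at most \<open>N\<close> with the \<open>N + 1\<close>
  roots \<open>0, ..., N\<close> is zero. This frees one coordinate at a time from the grid; a freed
  coordinate is absorbed into the base point \<open>x\<close>, over which the induction
  generalizes.\<close>

lemma vanishes_if_vanishes_on_grid: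
  assumes "finite B" "degree_on_lines_le N g"
    and "\<And>\<tau>. (\<And>b. b \<in> B \<Longrightarrow> \<tau> b \<in> real ` {..N}) \<Longrightarrow> g (x + (\<Sum>b\<in>B. \<tau> b *\<^sub>R b)) = 0"
  shows "g (x + (\<Sum>b\<in>B. \<sigma> b *\<^sub>R b)) = 0"
  using assms(1,3)
proof (induction B arbitrary: x \<sigma> rule: finite_induct)
  case empty
  then show ?case by simp
next
  case (insert b B)
  have "g (x + \<sigma> b *\<^sub>R b + (\<Sum>b\<in>B. \<sigma> b *\<^sub>R b)) = 0"
  proof (rule insert.IH)
    fix \<tau> :: "'a \<Rightarrow> real"
    assume \<tau>: "\<And>b. b \<in> B \<Longrightarrow> \<tau> b \<in> real ` {..N}"
    obtain p where p: "degree p \<le> N"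
      "\<And>t. g (x + (\<Sum>b\<in>B. \<tau> b *\<^sub>R b) + t *\<^sub>R b) = poly p t"
      using \<open>degree_on_lines_le N g\<close> unfolding degree_on_lines_le_def by metis
    have "poly p t = 0" if "t \<in> real ` {..N}" for t
    proof -
      have "(\<Sum>c\<in>B. (\<tau>(b := t)) c *\<^sub>R c) = (\<Sum>b\<in>B. \<tau> b *\<^sub>R b)"
        using insert.hyps by (intro sum.cong) auto
      then have "(\<Sum>c\<in>insert b B. (\<tau>(b := t)) c *\<^sub>R c) = t *\<^sub>R b + (\<Sum>b\<in>B. \<tau> b *\<^sub>R b)"
        using insert.hyps by (subst sum.insert) auto
      moreover have "g (x + (\<Sum>c\<in>insert b B. (\<tau>(b := t)) c *\<^sub>R c)) = 0"
        by (rule insert.prems) (use \<tau> that in auto)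
      ultimately show ?thesis
        by (simp add: p(2)[symmetric] algebra_simps)
    qed
    then have sub: "real ` {..N} \<subseteq> {t. poly p t = 0}" by auto
    have "p = 0"
    proof (rule ccontr)
      assume "p \<noteq> 0"
      then have "card (real ` {..N}) \<le> card {t. poly p t = 0}"
        by (intro card_mono poly_roots_finite sub)
      also have "\<dots> \<le> N"
        using \<open>p \<noteq> 0\<close> p(1) card_poly_roots_bound[of p] by simp
      finally show False
        by (simp add: card_image)
    qed
    then show "g (x + \<sigma> b *\<^sub>R b + (\<Sum>b\<in>B. \<tau> b *\<^sub>R b)) = 0"
      using p(2)[of "\<sigma> b"] by (simp add: algebra_simps)
  qed
  then show ?case
    using insert.hyps by (simp add: algebra_simps)
qed

text \<open>Gaussian elimination: each step removes one equation and at most one unknown, so an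
  unknown remains when the equations are exhausted.\<close>

lemma underdetermined_homogeneous_system:
  fixes c :: "'a \<Rightarrow> 'b \<Rightarrow> real"
  assumes "finite B" "finite A" "card B < card A"
  shows "\<exists>u. (\<exists>a\<in>A. u a \<noteq> 0) \<and> (\<forall>b\<in>B. (\<Sum>a\<in>A. u a * c a b) = 0)"
  using assms
proof (induction B arbitrary: A c rule: finite_induct)
  case empty
  then have "A \<noteq> {}" by auto
  then show ?case
    by (intro exI[of _ "\<lambda>_. 1"]) auto
next
  case (insert b B)
  show ?case
  proof (cases "\<forall>a\<in>A. c a b = 0")
    case True
    then show ?thesis
      using insert.IH[of A c] insert.hyps insert.prems by auto
  next
    case False
    then obtain e where e: "e \<in> A" "c e b \<noteq> 0" by blast
    have "card B < card (A - {e})"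
      using insert e by simp
    \<comment> \<open>The coefficients of the equations \<open>b'\<close> after the unknown of the
      pivot \<open>e\<close> has been eliminated with equation \<open>b\<close>.\<close>
    from insert.IH[OF _ this, of "\<lambda>a b'. c a b' - c e b' * c a b / c e b"]
    obtain u a where a: "a \<in> A" "a \<noteq> e" "u a \<noteq> 0"
      and u: "\<And>b'. b' \<in> B \<Longrightarrow> (\<Sum>a\<in>A - {e}. u a * (c a b' - c e b' * c a b / c e b)) = 0"
      using insert.prems by auto
    \<comment> \<open>The value of the unknown at \<open>e\<close> that equation \<open>b\<close>
      forces.\<close>
    define s where "s = - (\<Sum>a\<in>A - {e}. u a * c a b) / c e b"
    define v where "v = u(e := s)"
    have v: "(\<Sum>a\<in>A. v a * c a b') = s * c e b' + (\<Sum>a\<in>A - {e}. u a * c a b')" for b'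
    proof -
      have "(\<Sum>a\<in>A - {e}. v a * c a b') = (\<Sum>a\<in>A - {e}. u a * c a b')"
        by (intro sum.cong) (auto simp: v_def)
      then show ?thesis
        using sum.remove[of A e "\<lambda>a. v a * c a b'"] e insert.prems by (simp add: v_def)
    qed
    have "(\<Sum>a\<in>A. v a * c a b') = 0" if "b' \<in> B" for b'
    proof -
      have "(\<Sum>a\<in>A - {e}. u a * (c a b' - c e b' * c a b / c e b)) =
          (\<Sum>a\<in>A - {e}. u a * c a b' - (c e b' / c e b) * (u a * c a b))"
        by (intro sum.cong) (auto simp: algebra_simps)
      also have "\<dots> = (\<Sum>a\<in>A - {e}. u a * c a b') - (c e b' / c e b) * (\<Sum>a\<in>A - {e}. u a * c a b)"
        by (simp only: sum_subtractf sum_distrib_left)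
      also have "\<dots> = (\<Sum>a\<in>A. v a * c a b')"
        by (simp add: v s_def)
      finally show ?thesis
        using u[OF that] by simp
    qed
    moreover have "(\<Sum>a\<in>A. v a * c a b) = 0"
      using e by (simp add: v s_def)
    ultimately show ?thesis
      using a by (intro exI[of _ v]) (auto simp: v_def)
  qed
qed

text \<open>
  The candidates for the relation are the products \<open>R a\<close> of linear factors that vanish on a grid in
  the larger space except at \<open>a\<close>; this makes their linear independence obvious.  A combination
  composed with \<open>f\<close> has bounded degree, so that it vanishes as soon as it does so on a grid in \<open>L\<close>,
  and there are fewer such conditions than candidates.
\<close>

lemma algebraic_dependence_by_dimension:
  fixes f :: "'a::euclidean_space \<Rightarrow> 'b::euclidean_space"
  assumes f: "polynomial_function f" and L: "subspace L" and S: "subspace S"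
    and dim: "dim L < dim S"
  obtains P y where "real_polynomial_function P" "y \<in> S" "P y \<noteq> 0"
    "\<And>l. l \<in> L \<Longrightarrow> P (f (x + l)) = 0"
proof -
  obtain BL where BL: "independent BL" "span BL = L" "card BL = dim L"
    using orthonormal_basis_subspace[OF L] by metis
  obtain BS where BS: "BS \<subseteq> S" "pairwise orthogonal BS" "\<And>b. b \<in> BS \<Longrightarrow> norm b = 1"
      "independent BS" "card BS = dim S"
    using orthonormal_basis_subspace[OF S] by metis
  have fin: "finite BL" "finite BS"
    using BL(1) BS(4) independent_imp_finite by blast+
  have "\<forall>b. \<exists>N. degree_on_lines_le N (\<lambda>x. f x \<bullet> b)"
    using f by (intro allI real_polynomial_function_degree_on_lines)
      (auto simp: real_polynomial_function_eq)
  then obtain N0 where N0: "\<And>b. degree_on_lines_le (N0 b) (\<lambda>x. f x \<bullet> b)"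
    by metis
  define N where "N = (\<Sum>b\<in>BS. N0 b)"
  have N: "degree_on_lines_le N (\<lambda>x. f x \<bullet> b)" if "b \<in> BS" for b
    using degree_on_lines_le_mono[OF N0] that fin by (simp add: N_def member_le_sum)
  define k where "k = dim L"
  define m where "m = dim S"
  \<comment> \<open>A candidate \<open>R a\<close> has \<open>m * d\<close> linear factors, each of
    degree at most \<open>N\<close> after composition with \<open>f\<close>; this gives
    \<open>D\<close>. There are \<open>(d + 1) ^ m\<close> candidates and \<open>(D + 1) ^ k\<close>
    conditions. Since \<open>D + 1\<close> is at most \<open>(N * m + 1) * (d + 1)\<close>, this
    choice of \<open>d\<close> bounds the conditions by \<open>d * (d + 1) ^ k\<close>, which is
    below \<open>(d + 1) ^ Suc k\<close>.\<close>
  define d where "d = (N * m + 1) ^ k"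
  define D where "D = m * (d * N)"
  define A where "A = (BS \<rightarrow>\<^sub>E {..d})"
  define G where "G = (BL \<rightarrow>\<^sub>E {..D})"
  have "finite A" "finite G"
    unfolding A_def G_def by (intro finite_PiE fin; simp)+
  have "card G = (D + 1) ^ k"
    using fin by (simp add: G_def card_PiE BL(3) k_def)
  also have "\<dots> \<le> ((N * m + 1) * (d + 1)) ^ k"
    by (intro power_mono) (auto simp: D_def algebra_simps)
  also have "\<dots> < (d + 1) ^ Suc k"
  proof -
    have "((N * m + 1) * (d + 1)) ^ k = d * (d + 1) ^ k"
      by (simp only: power_mult_distrib d_def)
    then show ?thesis by simp
  qed
  also have "\<dots> \<le> (d + 1) ^ m"
    using dim by (intro power_increasing) (auto simp: k_def m_def)
  also have "\<dots> = card A"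
    using fin by (simp add: A_def card_PiE BS(5) m_def)
  finally have card: "card G < card A" .
  define R where "R a y = (\<Prod>s\<in>BS. \<Prod>j\<in>{..d} - {a s}. (y \<bullet> s - real j))" for a y
  define pt where "pt \<tau> = x + (\<Sum>b\<in>BL. real (\<tau> b) *\<^sub>R b)" for \<tau> :: "'a \<Rightarrow> nat"
  obtain u a where a: "a \<in> A" "u a \<noteq> 0"
    and u: "\<And>\<tau>. \<tau> \<in> G \<Longrightarrow> (\<Sum>a\<in>A. u a * R a (f (pt \<tau>))) = 0"
    using underdetermined_homogeneous_system[OF \<open>finite G\<close> \<open>finite A\<close> card,
        of "\<lambda>a \<tau>. R a (f (pt \<tau>))"] by metis
  define P where "P y = (\<Sum>a\<in>A. u a * R a y)" for y
  have "real_polynomial_function (\<lambda>y::'b. y \<bullet> s - c)" for s c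
  proof -
    have "real_polynomial_function (\<lambda>y::'b. y \<bullet> s + - c)"
      by (intro real_polynomial_function.intros bounded_linear_inner_left)
    then show ?thesis by simp
  qed
  then have "real_polynomial_function P"
    unfolding P_def R_def using \<open>finite A\<close> fin
    by (intro real_polynomial_function_sum real_polynomial_function_prod
        real_polynomial_function.intros(4)[OF real_polynomial_function.intros(2)]) auto
  \<comment> \<open>The grid point of an index with nonzero coefficient; every other candidate
    vanishes there, so nothing can cancel.\<close>
  define y where "y = (\<Sum>s\<in>BS. real (a s) *\<^sub>R s)"
  have "y \<in> S"
    unfolding y_def using BS(1) S by (intro subspace_sum subspace_scale) auto
  have ys: "y \<bullet> s = real (a s)" if "s \<in> BS" for s
  proof -
    have "y \<bullet> s = (\<Sum>t\<in>BS. real (a t) * (t \<bullet> s))"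
      by (simp add: y_def inner_sum_left)
    also have "\<dots> = (\<Sum>t\<in>BS. if t = s then real (a s) else 0)"
      using BS(2,3) that
      by (intro sum.cong) (auto simp: pairwise_def orthogonal_def dot_square_norm)
    finally show ?thesis
      using that fin by simp
  qed
  have "R a' y = 0" if a': "a' \<in> A" "a' \<noteq> a" for a'
  proof -
    obtain s where s: "s \<in> BS" "a s \<noteq> a' s"
      using PiE_ext[of a' BS _ a] a' \<open>a \<in> A\<close> unfolding A_def by metis
    moreover have "a s \<in> {..d}"
      using \<open>a \<in> A\<close> s unfolding A_def by auto
    ultimately have "(\<Prod>j\<in>{..d} - {a' s}. (y \<bullet> s - real j)) = 0"
      by (auto simp: ys)
    then show ?thesis
      unfolding R_def using fin s by auto
  qed
  then have "P y = u a * R a y"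
    unfolding P_def using \<open>finite A\<close> \<open>a \<in> A\<close> by (subst sum.remove[of _ a]) auto
  moreover have "R a y \<noteq> 0"
    unfolding R_def using fin by (auto simp: ys)
  ultimately have "P y \<noteq> 0"
    using a by simp
  have "degree_on_lines_le D (\<lambda>x. u b * R b (f x))" if "b \<in> A" for b
  proof -
    have "degree_on_lines_le (d * N) (\<lambda>x. \<Prod>j\<in>{..d} - {b s}. (f x \<bullet> s - real j))"
      if "s \<in> BS" for s
    proof -
      have "b s \<in> {..d}"
        using \<open>b \<in> A\<close> that unfolding A_def by auto
      then have "card ({..d} - {b s}) = d"
        by simp
      then show ?thesis
        using degree_on_lines_le_prod[of "{..d} - {b s}" N "\<lambda>j x. f x \<bullet> s + - real j"]
          degree_on_lines_le_add[OF N[OF that] degree_on_lines_le_const[of N]]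
        by (simp del: add_uminus_conv_diff add: diff_conv_add_uminus)
    qed
    then have "degree_on_lines_le D (\<lambda>x. R b (f x))"
      unfolding R_def D_def m_def BS(5)[symmetric] using fin by (intro degree_on_lines_le_prod)
    from degree_on_lines_le_mult[OF degree_on_lines_le_const[of 0] this]
    show ?thesis by simp
  qed
  then have deg: "degree_on_lines_le D (\<lambda>x. P (f x))"
    unfolding P_def by (intro degree_on_lines_le_sum \<open>finite A\<close>)
  have "P (f (x + l)) = 0" if l: "l \<in> L" for l
  proof -
    obtain c where c: "l = (\<Sum>b\<in>BL. c b *\<^sub>R b)"
      using l BL(2) span_finite[OF fin(1)] by auto
    have "P (f (x + (\<Sum>b\<in>BL. \<tau> b *\<^sub>R b))) = 0"
      if \<tau>: "\<And>b. b \<in> BL \<Longrightarrow> \<tau> b \<in> real ` {..D}" for \<tau>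
    proof -
      have "\<forall>b. \<exists>n. b \<in> BL \<longrightarrow> n \<le> D \<and> \<tau> b = real n"
        using \<tau> by blast
      then obtain n where n: "\<And>b. b \<in> BL \<Longrightarrow> n b \<le> D \<and> \<tau> b = real (n b)"
        by metis
      have "restrict n BL \<in> G"
        using n by (auto simp: G_def)
      moreover have "pt (restrict n BL) = x + (\<Sum>b\<in>BL. \<tau> b *\<^sub>R b)"
        unfolding pt_def using n by (intro arg_cong[where f = "(+) x"] sum.cong) auto
      ultimately show ?thesis
        using u[of "restrict n BL"] by (simp add: P_def)
    qed
    then show ?thesis
      unfolding c by (rule vanishes_if_vanishes_on_grid[OF fin(1) deg])
  qed
  then show ?thesis
    using that \<open>real_polynomial_function P\<close> \<open>y \<in> S\<close> \<open>P y \<noteq> 0\<close> by blast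
qed

section \<open>Rank and kernel of a linear map under perturbation\<close>

text \<open>An injective linear map is bounded below on \<open>L\<close>. In finite dimension,
  convergence on the basis vectors is convergence in operator norm, and a perturbation of norm below
  \<open>c / 2\<close> costs at most half of the bound.\<close>

lemma eventually_uniformly_injective:
  fixes J :: "real \<Rightarrow> 'a::euclidean_space \<Rightarrow> 'b::euclidean_space"
  assumes lin: "\<And>t. linear (J t)"
    and lim: "\<And>v. ((\<lambda>t. J t v) \<longlongrightarrow> J 0 v) (at 0)"
    and L: "subspace L" and inj: "\<And>v. v \<in> L \<Longrightarrow> J 0 v = 0 \<Longrightarrow> v = 0"
  obtains c where "c > 0" "\<forall>\<^sub>F t in at 0. \<forall>v\<in>L. c * norm v \<le> norm (J t v)"
proof -
  obtain c where c: "c > 0" "\<And>v. v \<in> L \<Longrightarrow> c * norm v \<le> norm (J 0 v)"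
    using injective_imp_isometric[OF closed_subspace[OF L] L, of "J 0"] inj lin
    by (auto simp: linear_conv_bounded_linear)
  define e where "e t = (\<Sum>b\<in>Basis. norm (J t b - J 0 b))" for t
  have "(e \<longlongrightarrow> (\<Sum>b\<in>(Basis :: 'a set). norm (J 0 b - J 0 b))) (at 0)"
    unfolding e_def by (intro tendsto_intros lim)
  then have "\<forall>\<^sub>F t in at 0. e t < c / 2"
    using c(1) by (intro order_tendstoD(2)[of _ 0]) auto
  then have "\<forall>\<^sub>F t in at 0. \<forall>v\<in>L. c / 2 * norm v \<le> norm (J t v)"
  proof eventually_elim
    case (elim t)
    show ?case
    proof
      fix v assume "v \<in> L"
      have *: "J t v - J 0 v = (\<Sum>b\<in>Basis. (v \<bullet> b) *\<^sub>R (J t b - J 0 b))"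
        by (subst (1 2) euclidean_representation[of v, symmetric])
           (simp only: linear_sum[OF lin] linear_scale[OF lin] scaleR_diff_right sum_subtractf)
      have "norm (J t v - J 0 v) \<le> (\<Sum>b\<in>Basis. norm v * norm (J t b - J 0 b))"
        unfolding * by (intro sum_norm_le) (auto intro!: mult_right_mono Basis_le_norm)
      also have "\<dots> \<le> c / 2 * norm v"
        using mult_left_mono[of "e t" "c / 2" "norm v"] elim
        by (simp add: e_def mult.commute sum_distrib_left)
      finally have "norm (J 0 v) - norm (J t v) \<le> c / 2 * norm v"
        using norm_triangle_ineq2[of "J 0 v" "J t v"] by (simp add: norm_minus_commute)
      then show "c / 2 * norm v \<le> norm (J t v)"
        using c(2)[OF \<open>v \<in> L\<close>] by linarith
    qed
  qed
  then show ?thesis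
    using that[of "c / 2"] c(1) by simp
qed

text \<open>Let \<open>L\<close> be the orthogonal complement of the kernel at 0. For small
  \<open>t\<close> the map \<open>J t\<close> stays injective on \<open>L\<close>, and as its rank
  cannot exceed that of \<open>J 0\<close>, it maps \<open>L\<close> onto its whole range. So
  \<open>J t w\<close> is matched by some \<open>l t\<close> in \<open>L\<close>; the uniform lower
  bound forces \<open>l t\<close> to 0, and \<open>w - l t\<close> is the continuation.\<close>

lemma kernel_vector_continuation:
  fixes J :: "real \<Rightarrow> 'a::euclidean_space \<Rightarrow> 'b::euclidean_space"
  assumes lin: "\<And>t. linear (J t)"
    and lim: "\<And>v. ((\<lambda>t. J t v) \<longlongrightarrow> J 0 v) (at 0)"
    and max: "\<And>t. dim (range (J t)) \<le> dim (range (J 0))"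
    and w: "J 0 w = 0"
  obtains W where "(W \<longlongrightarrow> w) (at 0)" "\<forall>\<^sub>F t in at 0. J t (W t) = 0"
proof -
  define L where "L = {v. J 0 v = 0}\<^sup>\<bottom>"
  have L: "subspace L"
    unfolding L_def by (rule subspace_orthogonal_comp)
  have ker: "subspace {v. J 0 v = 0}"
    using lin by (rule linear_subspace_kernel)
  have inj: "v = 0" if "v \<in> L" "J 0 v = 0" for v
    using that by (auto simp: L_def orthogonal_comp_def orthogonal_self)
  have "range (J 0) \<subseteq> J 0 ` L"
  proof clarify
    fix v
    obtain a b where ab: "a \<in> {v. J 0 v = 0}" "b \<in> L" "v = a + b"
      using orthogonal_subspace_decomp_exists[of "{v. J 0 v = 0}" v]
      by (auto simp: L_def orthogonal_comp_def span_eq_iff[THEN iffD2, OF ker] orthogonal_commute)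
    then show "J 0 v \<in> J 0 ` L"
      using linear_add[OF lin] by auto
  qed
  then have "dim (range (J 0)) \<le> dim L"
    using order_trans[OF dim_subset dim_image_le[OF lin]] by blast
  obtain c where c: "c > 0" "\<forall>\<^sub>F t in at 0. \<forall>v\<in>L. c * norm v \<le> norm (J t v)"
    by (rule eventually_uniformly_injective[OF lin lim L inj])
  have "\<forall>\<^sub>F t in at 0. \<exists>l. J t l = J t w \<and> c * norm l \<le> norm (J t w)"
    using c(2)
  proof eventually_elim
    case (elim t)
    have "inj_on (J t) L"
      unfolding linear_injective_on_subspace_0[OF lin L]
    proof clarify
      fix v assume "v \<in> L" "J t v = 0"
      then show "v = 0"
        using elim c(1) by (auto simp: mult_le_0_iff dest!: bspec[of L _ v])
    qed
    then have "dim (J t ` L) = dim L"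
      using L by (intro dim_image_eq lin) (simp add: span_eq_iff[THEN iffD2, OF L] \<open>inj_on (J t) L\<close>)
    then have "J t ` L = range (J t)"
      using max[of t] \<open>dim (range (J 0)) \<le> dim L\<close> lin L
      by (intro subspace_dim_equal linear_subspace_image subspace_UNIV) auto
    then obtain l where "l \<in> L" "J t l = J t w"
      by (metis imageE rangeI)
    then show ?case
      using elim by metis
  qed
  then obtain l where l: "\<forall>\<^sub>F t in at 0. J t (l t) = J t w \<and> c * norm (l t) \<le> norm (J t w)"
    by (subst (asm) eventually_ex) blast
  have "((\<lambda>t. norm (J t w) / c) \<longlongrightarrow> norm (J 0 w) / c) (at 0)"
    using c(1) by (intro tendsto_intros lim) auto
  then have "((\<lambda>t. norm (J t w) / c) \<longlongrightarrow> 0) (at 0)"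
    using w by simp
  moreover have "\<forall>\<^sub>F t in at 0. norm (l t) \<le> norm (J t w) / c"
    using l by eventually_elim (use c(1) in \<open>simp add: field_simps\<close>)
  ultimately have "(l \<longlongrightarrow> 0) (at 0)"
    by (rule Lim_null_comparison[rotated])
  then have "((\<lambda>t. w - l t) \<longlongrightarrow> w - 0) (at 0)"
    by (intro tendsto_intros)
  moreover have "\<forall>\<^sub>F t in at 0. J t (w - l t) = 0"
    using l by eventually_elim (simp add: linear_diff[OF lin])
  ultimately show ?thesis
    using that[of "\<lambda>t. w - l t"] by simp
qed

text \<open>
  At a point \<open>x0\<close> where the derivative has maximal rank, pick a relation that holds along \<open>x0 + L\<close>,
  where \<open>L\<close> is a complement of the kernel of the derivative.  The kernel varies continuously near
  \<open>x0\<close>, and the relation composed with \<open>f\<close> is stationary along it; hence the lowest order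
  term at \<open>x0\<close> is constant along the kernel at \<open>x0\<close>.  As it vanishes on \<open>L\<close>, it is zero.
\<close>

theorem algebraic_dependence_by_rank:
  fixes f :: "'a::euclidean_space \<Rightarrow> 'b::euclidean_space"
  assumes f: "polynomial_function f" and S: "subspace S"
    and der: "\<And>x. (f has_derivative f' x) (at x)"
    and cont: "\<And>x v. isCont (\<lambda>x. f' x v) x"
    and rank: "\<And>x. dim (range (f' x)) < dim S"
  obtains P y where "real_polynomial_function P" "y \<in> S" "P y \<noteq> 0" "\<And>x. P (f x) = 0"
proof -
  have lin: "linear (f' x)" for x
    using der has_derivative_linear by blast
  obtain x0 where x0: "\<And>x. dim (range (f' x)) \<le> dim (range (f' x0))"
    using ex_has_greatest_nat[of "\<lambda>_. True" undefined "\<lambda>x. dim (range (f' x))" "dim S"]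
      rank less_imp_le by blast
  define K where "K = {v. f' x0 v = 0}"
  define L where "L = K\<^sup>\<bottom>"
  have K: "subspace K"
    unfolding K_def using lin by (rule linear_subspace_kernel)
  have L: "subspace L"
    unfolding L_def by (rule subspace_orthogonal_comp)
  have "inj_on (f' x0) L"
    unfolding linear_injective_on_subspace_0[OF lin L]
    by (auto simp: L_def K_def orthogonal_comp_def orthogonal_self)
  then have "dim (f' x0 ` L) = dim L"
    by (intro dim_image_eq lin) (simp add: span_eq_iff[THEN iffD2, OF L])
  then have "dim L \<le> dim (range (f' x0))"
    by (metis dim_subset image_mono top_greatest)
  then have "dim L < dim S"
    using rank[of x0] by simp
  then obtain P y where P: "real_polynomial_function P" "y \<in> S" "P y \<noteq> 0"
      "\<And>l. l \<in> L \<Longrightarrow> P (f (x0 + l)) = 0"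
    using algebraic_dependence_by_dimension[OF f L S] by blast
  have "real_polynomial_function (\<lambda>x. P (f x))"
    using real_polynomial_function_compose[OF f P(1)] by (simp add: o_def)
  then obtain n G where G: "\<And>j. real_polynomial_function (G j)" "\<And>j u. j > n \<Longrightarrow> G j u = 0"
      and exp: "\<And>t u. P (f (x0 + t *\<^sub>R u)) = (\<Sum>j\<le>n. t ^ j * G j u)"
    using real_polynomial_function_expand[of "\<lambda>x. P (f x)" x0] by blast
  have "P (f x) = 0" for x
  proof (rule ccontr)
    assume "P (f x) \<noteq> 0"
    then have "(\<Sum>j\<le>n. G j (x - x0)) \<noteq> 0"
      using exp[of 1 "x - x0"] by simp
    then have ex: "\<exists>j u. G j u \<noteq> 0"
      by (meson sum.neutral)
    define s where "s = (LEAST j. \<exists>u. G j u \<noteq> 0)"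
    obtain u where u: "G s u \<noteq> 0"
      using LeastI_ex[OF ex] unfolding s_def by blast
    have low: "G j v = 0" if "j < s" for j v
      using not_less_Least[OF that[unfolded s_def]] by blast
    have "s \<le> n"
      using u G(2) by (meson not_le)
    obtain a b where "a \<in> span K" "\<And>w. w \<in> span K \<Longrightarrow> orthogonal b w" "u = a + b"
      by (rule orthogonal_subspace_decomp_exists[of K u]) blast
    then have a: "a \<in> K" and b: "b \<in> L" and ab: "u = b + a"
      by (auto simp: L_def orthogonal_comp_def span_eq_iff[THEN iffD2, OF K] orthogonal_commute)
    \<comment> \<open>The relation vanishes on the whole line through \<open>x0\<close> in the
      direction \<open>b\<close>, so the direction stays constant here.\<close>
    have "G s b = 0"
    proof (rule leading_coefficient_limit[where H = "\<lambda>j _. G j b" and z = "\<lambda>_. 0 :: real"])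
      show "\<forall>\<^sub>F t in at 0. (\<Sum>j\<le>n. t ^ j * G j b) = 0"
        using exp[of _ b] P(4) subspace_scale[OF L b] by simp
    qed (use low \<open>s \<le> n\<close> in auto)
    define G' where "G' j v = frechet_derivative (G j) (at v)" for j v
    have G': "(G j has_derivative G' j v) (at v)" for j v
      unfolding G'_def using G(1) differentiable_at_real_polynomial_function frechet_derivative_works
      by blast
    \<comment> \<open>The expansion is differentiated in \<open>v\<close> with \<open>t\<close>
      fixed. By the chain rule the derivative factors through
      \<open>f' (x0 + t *\<^sub>R v)\<close>, so it kills the continued kernel vector
      \<open>W t\<close>; its lowest order term in \<open>t\<close> is
      \<open>G' s v a\<close>.\<close>
    have "G' s v a = 0" for v
    proof -
      obtain W where W: "(W \<longlongrightarrow> a) (at 0)" "\<forall>\<^sub>F t in at 0. f' (x0 + t *\<^sub>R v) (W t) = 0"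
      proof (rule kernel_vector_continuation[of "\<lambda>t. f' (x0 + t *\<^sub>R v)" a])
        have "isCont (\<lambda>t::real. x0 + t *\<^sub>R v) 0"
          by (intro continuous_intros)
        then show "((\<lambda>t. f' (x0 + t *\<^sub>R v) w) \<longlongrightarrow> f' (x0 + 0 *\<^sub>R v) w) (at 0)" for w
          using isCont_o2[where f = "\<lambda>t. x0 + t *\<^sub>R v" and g = "\<lambda>x. f' x w" and a = 0] cont by (simp add: isCont_def)
      qed (use lin x0 a in \<open>auto simp: K_def\<close>)
      show ?thesis
      proof (rule leading_coefficient_limit[where H = "\<lambda>j. G' j v" and z = W])
        show "isCont (G' j v) a" for j
          using G' has_derivative_bounded_linear linear_continuous_at by blast
        show "G' j v (W t) = 0" if "j < s" for j t
        proof -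
          have "G j = (\<lambda>_. 0)"
            using low[OF that] by auto
          then show ?thesis
            by (simp add: G'_def)
        qed
        show "\<forall>\<^sub>F t in at 0. (\<Sum>j\<le>n. t ^ j * G' j v (W t)) = 0"
          using W(2)
        proof eventually_elim
          case (elim t)
          obtain P' where P': "(P has_derivative P') (at (f (x0 + t *\<^sub>R v)))"
            using P(1) differentiable_at_real_polynomial_function unfolding differentiable_def by blast
          have 1: "((\<lambda>v. x0 + t *\<^sub>R v) has_derivative (\<lambda>w. t *\<^sub>R w)) (at v)"
            by (auto intro!: derivative_eq_intros)
          have "((\<lambda>v. P (f (x0 + t *\<^sub>R v))) has_derivative (\<lambda>w. P' (f' (x0 + t *\<^sub>R v) (t *\<^sub>R w)))) (at v)"
            using has_derivative_compose[OF has_derivative_compose[OF 1 der] P'] .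
          moreover have "((\<lambda>v. P (f (x0 + t *\<^sub>R v))) has_derivative (\<lambda>w. \<Sum>j\<le>n. t ^ j * G' j v w)) (at v)"
            unfolding exp by (intro derivative_intros G')
          ultimately have "(\<Sum>j\<le>n. t ^ j * G' j v w) = P' (f' (x0 + t *\<^sub>R v) (t *\<^sub>R w))" for w
            using has_derivative_unique[THEN fun_cong] by blast
          then show ?case
            using elim linear_0[OF has_derivative_linear[OF P']] by (simp add: linear_scale[OF lin])
        qed
      qed (use W(1) \<open>s \<le> n\<close> in auto)
    qed
    have "((\<lambda>\<tau>. G s (b + \<tau> *\<^sub>R a)) has_real_derivative 0) (at \<tau>)" for \<tau>
    proof -
      have 1: "((\<lambda>\<tau>. b + \<tau> *\<^sub>R a) has_derivative (\<lambda>h. h *\<^sub>R a)) (at \<tau>)"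
        by (auto intro!: derivative_eq_intros)
      show ?thesis
        using has_derivative_compose[OF 1 G'[of s]] \<open>\<And>v. G' s v a = 0\<close>
        by (simp add: has_field_derivative_def linear_scale[OF has_derivative_linear[OF G']] lambda_zero)
    qed
    then have "G s (b + 1 *\<^sub>R a) = G s (b + 0 *\<^sub>R a)"
      using DERIV_isconst_all[of "\<lambda>\<tau>. G s (b + \<tau> *\<^sub>R a)"] by blast
    then show False
      using u \<open>G s b = 0\<close> ab by simp
  qed
  then show ?thesis
    using that P by blast
qed

subsection \<open>Unique minimizers\<close>

lemma subspace_graph_matrices: "subspace (graph_matrices E)"
  by (auto simp: subspace_def graph_matrices_def symmetric_matrices_def transpose_def vec_eq_iff)

lemma mat_1_in_posdiag_graph_matrices: "mat 1 \<in> posdiag_graph_matrices E"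
  unfolding posdiag_graph_matrices_def graph_matrices_def symmetric_matrices_def
  by (simp add: transpose_mat) (simp add: mat_def)

lemma inner_matrix_vector_mult: "(A *v x) \<bullet> y = x \<bullet> (transpose A *v y)" for A :: "real^'n^'m"
  by (metis dot_lmul_matrix inner_commute transpose_matrix_vector transpose_transpose)

lemma column_matrix_mult: "column j (A ** B) = A *v column j B"
  by (simp add: column_def matrix_matrix_mult_def matrix_vector_mult_def vec_eq_iff)

text \<open>The form is nonnegative at \<open>x - t *\<^sub>R y\<close> with
  \<open>y = A *v x\<close>. There the linear term in \<open>t\<close> is
  \<open>- 2 * t * (y \<bullet> y)\<close>, which would win over the quadratic one for small
  positive \<open>t\<close> unless \<open>y = 0\<close>.\<close>

lemma pos_semidef_null_vector:
  assumes "pos_semidef A" "x \<bullet> (A *v x) = 0"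
  shows "A *v x = 0"
proof -
  define y where "y = A *v x"
  have sym: "transpose A = A"
    using assms by (simp add: pos_semidef_def symmetric_matrices_def)
  have xy: "x \<bullet> (A *v y) = y \<bullet> y" "y \<bullet> (A *v x) = y \<bullet> y"
    by (metis inner_commute inner_matrix_vector_mult sym y_def)+
  have *: "0 \<le> - 2 * t * (y \<bullet> y) + t\<^sup>2 * (y \<bullet> (A *v y))" for t
  proof -
    have "0 \<le> (x - t *\<^sub>R y) \<bullet> (A *v (x - t *\<^sub>R y))"
      using assms by (simp add: pos_semidef_def)
    also have "\<dots> = - 2 * t * (y \<bullet> y) + t\<^sup>2 * (y \<bullet> (A *v y))"
      using assms xy
      by (simp add: matrix_vector_mult_diff_distrib matrix_vector_mult_scaleR inner_diff_left
          inner_diff_right algebra_simps power2_eq_square)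
    finally show ?thesis .
  qed
  define c where "c = y \<bullet> (A *v y)"
  have "c \<ge> 0"
    using assms by (simp add: pos_semidef_def c_def)
  have "y \<bullet> y \<le> 0"
  proof (rule ccontr)
    assume "\<not> y \<bullet> y \<le> 0"
    \<comment> \<open>Small enough that \<open>r * c\<close> is at most
      \<open>y \<bullet> y\<close>; the summand 1 keeps the denominator positive when
      \<open>c = 0\<close>.\<close>
    define r where "r = (y \<bullet> y) / (c + 1)"
    have "r > 0"
      unfolding r_def using \<open>\<not> y \<bullet> y \<le> 0\<close> \<open>c \<ge> 0\<close> by (intro divide_pos_pos) linarith+
    have "2 * (y \<bullet> y) * r \<le> r * r * c"
      using *[of r] by (simp add: c_def power2_eq_square algebra_simps)
    then have "2 * (y \<bullet> y) \<le> r * c"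
      using \<open>r > 0\<close> by (simp add: algebra_simps)
    also have "\<dots> \<le> y \<bullet> y"
      using \<open>c \<ge> 0\<close> by (simp add: r_def field_simps)
    finally show False
      using \<open>\<not> y \<bullet> y \<le> 0\<close> by simp
  qed
  then have "y = 0"
    using inner_ge_zero[of y] inner_eq_zero_iff[of y] by linarith
  then show ?thesis
    by (simp add: y_def)
qed

section \<open>The quadratic part of the objective\<close>

definition concord_form :: "real^'n^'n \<Rightarrow> real^'n^'n \<Rightarrow> real" where
  "concord_form A \<Omega> = (\<Sum>i\<in>UNIV. column i \<Omega> \<bullet> (A *v column i \<Omega>))"

lemma column_linear:
  "column i (x + y) = column i x + column i y" "column i (c *\<^sub>R x) = c *\<^sub>R column i x"
  "column i (x - y) = column i x - column i y"
  by (simp_all add: column_def vec_eq_iff)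

lemma concord_form_pos:
  fixes A :: "real^'n^'n"
  assumes A: "pos_semidef A" and "A ** \<Omega> \<noteq> 0"
  shows "concord_form A \<Omega> > 0"
proof -
  obtain i where i: "A *v column i \<Omega> \<noteq> 0"
  proof -
    have "\<exists>i. column i (A ** \<Omega>) \<noteq> 0"
      using assms(2) by (auto simp: column_def vec_eq_iff)
    then show ?thesis
      using that by (auto simp: column_matrix_mult)
  qed
  have "0 < column i \<Omega> \<bullet> (A *v column i \<Omega>)"
    using A pos_semidef_null_vector[OF A] i by (metis order_le_less pos_semidef_def)
  also have "\<dots> \<le> concord_form A \<Omega>"
    using A by (auto simp: concord_form_def pos_semidef_def intro!: member_le_sum)
  finally show ?thesis .
qed

lemma concord_form_scale: "concord_form A (c *\<^sub>R \<Omega>) = c\<^sup>2 * concord_form A \<Omega>"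
  by (simp add: concord_form_def column_linear matrix_vector_mult_scaleR sum_distrib_left
      power2_eq_square mult_ac)

text \<open>The parallelogram law; the last term is the gain that makes the objective strictly
  convex whenever \<open>A ** (x - y)\<close> is nonzero.\<close>

lemma concord_form_midpoint:
  "concord_form A ((1/2) *\<^sub>R (x + y)) =
     (concord_form A x + concord_form A y) / 2 - concord_form A (x - y) / 4"
proof -
  have "column i ((1/2) *\<^sub>R (x + y)) \<bullet> (A *v column i ((1/2) *\<^sub>R (x + y))) =
    (column i x \<bullet> (A *v column i x) + column i y \<bullet> (A *v column i y)) / 2
    - column i (x - y) \<bullet> (A *v column i (x - y)) / 4" for i
    by (simp add: column_linear matrix_vector_mult_scaleR matrix_vector_mult_diff_distrib
        matrix_vector_right_distrib inner_add_left inner_add_right inner_diff_left inner_diff_right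
        field_simps)
  then show ?thesis
    by (simp add: concord_form_def sum_subtractf sum.distrib flip: sum_divide_distrib)
qed

lemma continuous_on_concord_form: "continuous_on S (concord_form A)"
  unfolding concord_form_def column_def matrix_vector_mult_def inner_vec_def
  by (auto intro!: continuous_intros)

text \<open>The form is positive on the compact unit sphere of \<open>graph_matrices E\<close>; its
  minimum there serves as \<open>c\<close>, by homogeneity of degree two.\<close>

lemma concord_form_coercive:
  fixes A :: "real^'n^'n"
  assumes A: "pos_semidef A" and null: "\<And>\<Omega>. \<Omega> \<in> graph_matrices E \<Longrightarrow> A ** \<Omega> = 0 \<Longrightarrow> \<Omega> = 0"
  obtains c where "c > 0" "\<And>\<Omega>. \<Omega> \<in> graph_matrices E \<Longrightarrow> c * (norm \<Omega>)\<^sup>2 \<le> concord_form A \<Omega>"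
proof -
  define K where "K = graph_matrices E \<inter> sphere 0 1"
  have "compact K"
    unfolding K_def by (intro closed_Int_compact closed_subspace subspace_graph_matrices compact_sphere)
  have normalize: "(1 / norm \<Omega>) *\<^sub>R \<Omega> \<in> K" if "\<Omega> \<in> graph_matrices E" "\<Omega> \<noteq> 0" for \<Omega>
    using that subspace_scale[OF subspace_graph_matrices] by (auto simp: K_def)
  have "mat 1 \<noteq> (0 :: real^'n^'n)"
    by (auto simp: mat_def vec_eq_iff)
  then have "K \<noteq> {}"
    using normalize mat_1_in_posdiag_graph_matrices[of E] by (auto simp: posdiag_graph_matrices_def)
  then obtain m where m: "m \<in> K" "\<And>x. x \<in> K \<Longrightarrow> concord_form A m \<le> concord_form A x"
    using continuous_attains_inf[OF \<open>compact K\<close> _ continuous_on_concord_form] by metis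
  have "concord_form A m > 0"
    using null[of m] m(1) by (intro concord_form_pos A) (auto simp: K_def)
  moreover have "concord_form A m * (norm \<Omega>)\<^sup>2 \<le> concord_form A \<Omega>" if "\<Omega> \<in> graph_matrices E" for \<Omega>
  proof (cases "\<Omega> = 0")
    case True
    then show ?thesis
      by (simp add: concord_form_def column_def inner_vec_def)
  next
    case False
    from m(2)[OF normalize[OF that False]] False show ?thesis
      by (simp add: concord_form_scale field_simps)
  qed
  ultimately show ?thesis
    using that by blast
qed

text \<open>For existence, the sublevel set of the identity matrix lies in a compact set: quadratic
  growth beats the logarithms for large \<open>\<Omega>\<close>, and the logarithms keep the
  diagonal away from 0. For uniqueness, two minimizers would be beaten by their midpoint.\<close>

lemma unique_minimizer_if_injective:
  fixes A :: "real^'n^'n"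
  assumes A: "pos_semidef A" and null: "\<And>\<Omega>. \<Omega> \<in> graph_matrices E \<Longrightarrow> A ** \<Omega> = 0 \<Longrightarrow> \<Omega> = 0"
  shows "unique_minimizer E A"
proof -
  let ?D = "posdiag_graph_matrices E"
  obtain c where c: "c > 0" "\<And>\<Omega>. \<Omega> \<in> graph_matrices E \<Longrightarrow> c * (norm \<Omega>)\<^sup>2 \<le> concord_form A \<Omega>"
    using concord_form_coercive[OF assms] by blast
  have concord: "concord A \<Omega> = - 2 * (\<Sum>i\<in>UNIV. ln (\<Omega> $ i $ i)) + concord_form A \<Omega>" for \<Omega>
    by (simp add: concord_def concord_form_def)
  note I = mat_1_in_posdiag_graph_matrices[of E]
  define p where "p = real CARD('n)"
  define C0 where "C0 = concord A (mat 1)"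
  \<comment> \<open>Beyond the quotient, \<open>c * norm \<Omega>\<close> exceeds
    \<open>2 * p + \<bar>C0\<bar>\<close>; the maximum with 1 allows \<open>\<bar>C0\<bar>\<close>
    to be replaced by \<open>\<bar>C0\<bar> * norm \<Omega>\<close>.\<close>
  define R where "R = max 1 ((2 * p + \<bar>C0\<bar>) / c)"
  \<comment> \<open>Once \<open>norm \<Omega>\<close> is at most \<open>R\<close>, the other
    logarithms add up to at most \<open>p * R\<close>, so a value of at most \<open>C0\<close>
    leaves exactly this lower bound for each diagonal entry.\<close>
  define e where "e = exp (- (C0 + 2 * p * R) / 2)"
  define K where "K = {\<Omega> \<in> graph_matrices E. \<Omega> \<in> cball 0 R \<and> (\<forall>i. e \<le> \<Omega> $ i $ i)}"
  have entry: "\<Omega> $ i $ i \<le> norm \<Omega>" for \<Omega> :: "real^'n^'n" and i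
    by (meson Finite_Cartesian_Product.norm_nth_le abs_le_D1 component_le_norm_cart order_trans)
  have lnle: "ln (\<Omega> $ i $ i) \<le> norm \<Omega>" if "\<Omega> \<in> ?D" for \<Omega> i
    using that entry[of \<Omega> i] ln_le_minus_one[of "\<Omega> $ i $ i"]
    by (auto simp: posdiag_graph_matrices_def intro: order_trans)
  have sub: "\<Omega> \<in> K" if \<Omega>: "\<Omega> \<in> ?D" "concord A \<Omega> \<le> C0" for \<Omega>
  proof -
    have G: "\<Omega> \<in> graph_matrices E" and pos: "\<And>i. \<Omega> $ i $ i > 0"
      using \<Omega> by (auto simp: posdiag_graph_matrices_def)
    have form: "c * (norm \<Omega>)\<^sup>2 \<le> C0 + 2 * (\<Sum>i\<in>UNIV. ln (\<Omega> $ i $ i))"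
      using c(2)[OF G] \<Omega>(2) by (simp add: concord)
    have "(\<Sum>i\<in>UNIV. ln (\<Omega> $ i $ i)) \<le> p * norm \<Omega>"
      using sum_mono[of UNIV "\<lambda>i. ln (\<Omega> $ i $ i)" "\<lambda>_. norm \<Omega>"] lnle[OF \<Omega>(1)] by (simp add: p_def)
    with form have *: "c * (norm \<Omega>)\<^sup>2 \<le> C0 + 2 * p * norm \<Omega>"
      by simp
    have R: "norm \<Omega> \<le> R"
    proof (rule ccontr)
      assume "\<not> norm \<Omega> \<le> R"
      then have n: "norm \<Omega> > 1" "norm \<Omega> > (2 * p + \<bar>C0\<bar>) / c"
        by (auto simp: R_def)
      then have "(2 * p + \<bar>C0\<bar>) * norm \<Omega> < c * norm \<Omega> * norm \<Omega>"
        using c(1) by (intro mult_strict_right_mono) (auto simp: field_simps)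
      also have "\<dots> \<le> C0 + 2 * p * norm \<Omega>"
        using * by (simp add: power2_eq_square mult.assoc)
      also have "\<dots> \<le> \<bar>C0\<bar> * norm \<Omega> + 2 * p * norm \<Omega>"
        using n(1) mult_left_mono[of 1 "norm \<Omega>" "\<bar>C0\<bar>"] by simp
      finally show False
        by (simp add: algebra_simps)
    qed
    have "e \<le> \<Omega> $ i $ i" for i
    proof -
      have "(\<Sum>i\<in>UNIV. ln (\<Omega> $ i $ i)) = ln (\<Omega> $ i $ i) + (\<Sum>j\<in>UNIV - {i}. ln (\<Omega> $ j $ j))"
        by (simp add: sum.remove)
      also have "(\<Sum>j\<in>UNIV - {i}. ln (\<Omega> $ j $ j)) \<le> (\<Sum>j\<in>UNIV - {i}. R)"
        using lnle[OF \<Omega>(1)] R by (intro sum_mono) (meson order_trans)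
      also have "\<dots> \<le> p * R"
        by (auto simp: p_def R_def intro!: mult_right_mono)
      finally have "0 \<le> C0 + 2 * ln (\<Omega> $ i $ i) + 2 * p * R"
        using form mult_nonneg_nonneg[OF less_imp_le[OF c(1)] zero_le_power2[of "norm \<Omega>"]] by linarith
      then have "- (C0 + 2 * p * R) / 2 \<le> ln (\<Omega> $ i $ i)"
        by simp
      then show ?thesis
        unfolding e_def using pos[of i] by (metis exp_le_cancel_iff exp_ln)
    qed
    with R G show ?thesis
      by (simp add: K_def)
  qed
  have KD: "K \<subseteq> ?D"
    by (auto simp: K_def posdiag_graph_matrices_def e_def intro: less_le_trans[OF exp_gt_zero])
  have "closed {\<Omega> :: real^'n^'n. \<forall>i. e \<le> \<Omega> $ i $ i}"
    by (intro closed_Collect_all closed_Collect_le continuous_intros)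
  moreover have "K = graph_matrices E \<inter> {\<Omega>. \<forall>i. e \<le> \<Omega> $ i $ i} \<inter> cball 0 R"
    by (auto simp: K_def)
  ultimately have "compact K"
    by (simp add: closed_Int closed_Int_compact closed_subspace subspace_graph_matrices)
  moreover have "K \<noteq> {}"
    using sub[OF I] by (auto simp: C0_def)
  moreover have "continuous_on K (concord A)"
  proof -
    have "\<Omega> $ i $ i \<noteq> 0" if "\<Omega> \<in> K" for \<Omega> i
      using subsetD[OF KD that] by (auto simp: posdiag_graph_matrices_def less_imp_neq[symmetric])
    then show ?thesis
      unfolding concord by (intro continuous_intros continuous_on_concord_form) auto
  qed
  ultimately obtain m where m: "m \<in> K" "\<And>\<Omega>. \<Omega> \<in> K \<Longrightarrow> concord A m \<le> concord A \<Omega>"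
    using continuous_attains_inf by metis
  have min: "concord A m \<le> concord A \<Omega>" if "\<Omega> \<in> ?D" for \<Omega>
  proof (cases "concord A \<Omega> \<le> C0")
    case True
    then show ?thesis
      using sub m(2) that by blast
  next
    case False
    moreover have "concord A m \<le> C0"
      using m(2) sub[OF I] by (simp add: C0_def)
    ultimately show ?thesis
      by simp
  qed
  show ?thesis
    unfolding unique_minimizer_def
  proof (rule ex1I[of _ m])
    show "is_arg_min (concord A) (\<lambda>\<Omega>. \<Omega> \<in> ?D) m"
      using m(1) KD min by (force simp: is_arg_min_def)
  next
    fix w assume "is_arg_min (concord A) (\<lambda>\<Omega>. \<Omega> \<in> ?D) w"
    then have w: "w \<in> ?D" "concord A w \<le> concord A m"
      using m(1) KD by (auto simp: is_arg_min_def not_less)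
    have mD: "m \<in> ?D"
      using m(1) KD by blast
    show "w = m"
    proof (rule ccontr)
      assume "w \<noteq> m"
      define h where "h = (1/2) *\<^sub>R (w + m)"
      have G: "w \<in> graph_matrices E" "m \<in> graph_matrices E"
        using w(1) mD by (auto simp: posdiag_graph_matrices_def)
      have hD: "h \<in> ?D"
        using w(1) mD G unfolding h_def posdiag_graph_matrices_def
        by (auto intro!: subspace_scale subspace_add subspace_graph_matrices add_pos_pos)
      have "A ** (w - m) \<noteq> 0"
        using null[of "w - m"] G \<open>w \<noteq> m\<close> subspace_diff[OF subspace_graph_matrices] by auto
      then have "concord_form A (w - m) > 0"
        by (rule concord_form_pos[OF A])
      then have q: "concord_form A h < (concord_form A w + concord_form A m) / 2"
        unfolding h_def concord_form_midpoint by linarith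
      \<comment> \<open>Midpoint concavity of the logarithm, from the inequality of the arithmetic
        and geometric means.\<close>
      have "(ln (w $ i $ i) + ln (m $ i $ i)) / 2 \<le> ln (h $ i $ i)" for i
      proof -
        have pos: "w $ i $ i > 0" "m $ i $ i > 0"
          using w(1) mD by (auto simp: posdiag_graph_matrices_def)
        have "(w $ i $ i) * (m $ i $ i) \<le> (h $ i $ i)\<^sup>2"
          using zero_le_power2[of "w $ i $ i - m $ i $ i"]
          by (simp add: h_def power2_eq_square field_simps)
        then have "ln ((w $ i $ i) * (m $ i $ i)) \<le> ln ((h $ i $ i)\<^sup>2)"
          using pos by (intro ln_mono) auto
        moreover have "h $ i $ i > 0"
          using hD by (auto simp: posdiag_graph_matrices_def)
        ultimately show ?thesis
          using pos by (simp add: ln_mult ln_realpow)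
      qed
      then have "(\<Sum>i\<in>UNIV. (ln (w $ i $ i) + ln (m $ i $ i)) / 2) \<le> (\<Sum>i\<in>UNIV. ln (h $ i $ i))"
        by (intro sum_mono)
      then have "concord A h < (concord A w + concord A m) / 2"
        using q by (simp add: concord sum.distrib flip: sum_divide_distrib)
      then show False
        using min[OF hD] w(2) by simp
    qed
  qed
qed

subsection \<open>Degeneracy and general position\<close>

lemma degeneracy_property:
  fixes E :: "'n::finite set set"
  assumes "W \<noteq> {}" "F \<subseteq> E" "\<Union>F \<subseteq> W"
  shows "\<exists>v\<in>W. card {e \<in> F. v \<in> e} \<le> degeneracy E"
proof -
  let ?P = "\<lambda>d. \<forall>W F. W \<noteq> {} \<and> F \<subseteq> E \<and> \<Union>F \<subseteq> W \<longrightarrow> (\<exists>v\<in>W. card {e \<in> F. v \<in> e} \<le> d)"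
  have "?P (card E)"
    by (metis (no_types, lifting) card_mono equals0I finite mem_Collect_eq order_trans subsetI)
  then have "?P (degeneracy E)"
    unfolding degeneracy_def by (rule LeastI)
  then show ?thesis
    using assms by blast
qed

lemma card_edges_at:
  fixes E :: "'n::finite set set"
  assumes "simple_graph E"
  shows "card {e \<in> E. v \<in> e} = card {i. i \<noteq> v \<and> {i, v} \<in> E}"
proof -
  have "{e \<in> E. v \<in> e} = (\<lambda>i. {i, v}) ` {i. i \<noteq> v \<and> {i, v} \<in> E}"
  proof (intro equalityI subsetI)
    fix e assume e: "e \<in> {e \<in> E. v \<in> e}"
    then obtain i j where "e = {i, j}" "i \<noteq> j"
      using assms by (auto simp: simple_graph_def)
    then show "e \<in> (\<lambda>i. {i, v}) ` {i. i \<noteq> v \<and> {i, v} \<in> E}"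
      using e by (cases "v = i") (auto simp: insert_commute)
  qed auto
  moreover have "inj_on (\<lambda>i. {i, v}) {i. i \<noteq> v \<and> {i, v} \<in> E}"
    by (auto simp: inj_on_def doubleton_eq_iff)
  ultimately show ?thesis
    by (simp add: card_image)
qed

text \<open>Guarantees that \<open>degeneracy E + 1\<close> rows can be indexed by vertices, as the
  encoding by square matrices demands.\<close>

lemma degeneracy_less_card:
  fixes E :: "'n::finite set set"
  assumes "simple_graph E"
  shows "degeneracy E < CARD('n)"
proof -
  have "degeneracy E \<le> CARD('n) - 1"
    unfolding degeneracy_def
  proof (rule Least_le, intro allI impI)
    fix W :: "'n set" and F
    assume WF: "W \<noteq> {} \<and> F \<subseteq> E \<and> \<Union>F \<subseteq> W"
    then obtain v where "v \<in> W" by blast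
    have "card {e \<in> F. v \<in> e} \<le> card {e \<in> E. v \<in> e}"
      using WF by (intro card_mono) auto
    also have "\<dots> \<le> card (UNIV - {v})"
      unfolding card_edges_at[OF assms] by (intro card_mono) auto
    finally show "\<exists>v\<in>W. card {e \<in> F. v \<in> e} \<le> CARD('n) - 1"
      using \<open>v \<in> W\<close> by (auto simp: card_Diff_singleton)
  qed
  moreover have "CARD('n) > 0"
    by simp
  ultimately show ?thesis
    by linarith
qed

text \<open>Degeneracy is applied to the subgraph induced on the nonzero columns. By symmetry a
  nonzero entry in row \<open>i\<close> makes column \<open>i\<close> nonzero too, so the support of
  column \<open>v\<close> stays inside this subgraph: it consists of neighbours of \<open>v\<close>
  and possibly \<open>v\<close> itself, which accounts for the summand 1.\<close>

lemma graph_matrix_sparse_column: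
  fixes E :: "'n::finite set set"
  assumes E: "simple_graph E" and \<Omega>: "\<Omega> \<in> graph_matrices E" "\<Omega> \<noteq> 0"
  obtains v where "column v \<Omega> \<noteq> 0" "card {i. \<Omega> $ i $ v \<noteq> 0} \<le> degeneracy E + 1"
proof -
  have sym: "\<Omega> $ i $ j = \<Omega> $ j $ i" for i j
    using \<Omega>(1) by (auto simp: graph_matrices_def symmetric_matrices_def transpose_def vec_eq_iff)
  define W where "W = {v. column v \<Omega> \<noteq> 0}"
  define F where "F = {e \<in> E. e \<subseteq> W}"
  have "W \<noteq> {}"
    using \<Omega>(2) by (auto simp: W_def column_def vec_eq_iff)
  then obtain v where v: "v \<in> W" "card {e \<in> F. v \<in> e} \<le> degeneracy E"
    using degeneracy_property[of W F E] by (auto simp: F_def)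
  have "simple_graph F"
    using E by (auto simp: F_def simple_graph_def)
  have "{i. \<Omega> $ i $ v \<noteq> 0} \<subseteq> insert v {i. i \<noteq> v \<and> {i, v} \<in> F}"
  proof
    fix i assume i: "i \<in> {i. \<Omega> $ i $ v \<noteq> 0}"
    then have "\<Omega> $ v $ i \<noteq> 0"
      using sym by simp
    then have "i \<in> W"
      by (auto simp: W_def column_def vec_eq_iff)
    with i v(1) \<Omega>(1) show "i \<in> insert v {i. i \<noteq> v \<and> {i, v} \<in> F}"
      by (auto simp: graph_matrices_def F_def)
  qed
  then have "card {i. \<Omega> $ i $ v \<noteq> 0} \<le> card (insert v {i. i \<noteq> v \<and> {i, v} \<in> F})"
    by (intro card_mono) auto
  also have "\<dots> \<le> degeneracy E + 1"
    using v(2) card_edges_at[OF \<open>simple_graph F\<close>, of v] by simp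
  finally show ?thesis
    using that[of v] v(1) by (simp add: W_def)
qed

text \<open>On the support \<open>S\<close> of \<open>x\<close> the principal submatrix has full
  rank, so its range is all vectors supported in \<open>S\<close>. It also annihilates
  \<open>x\<close>. Range and kernel of a symmetric matrix are orthogonal, hence \<open>x\<close> is
  orthogonal to itself.\<close>

lemma general_position_null_vector:
  fixes A :: "real^'n^'n"
  assumes A: "general_position A" and x: "A *v x = 0" and card: "card {i. x $ i \<noteq> 0} \<le> rank A"
  shows "x = 0"
proof -
  define S where "S = {i. x $ i \<noteq> 0}"
  define B where "B = principal_submatrix S A"
  define U where "U = {y :: real^'n. \<forall>i. i \<notin> S \<longrightarrow> y $ i = 0}"
  have sym: "A $ i $ j = A $ j $ i" for i j
    using A by (auto simp: general_position_def symmetric_matrices_def transpose_def vec_eq_iff)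
  have "transpose B = B"
    by (auto simp: B_def principal_submatrix_def transpose_def vec_eq_iff sym)
  have "B *v x = 0"
  proof -
    have "(\<Sum>j\<in>UNIV. (if i \<in> S \<and> j \<in> S then A $ i $ j else 0) * x $ j) =
        (if i \<in> S then (A *v x) $ i else 0)" for i
      by (auto simp: matrix_vector_mult_def S_def intro!: sum.cong)
    moreover have "(B *v x) $ i = (\<Sum>j\<in>UNIV. (if i \<in> S \<and> j \<in> S then A $ i $ j else 0) * x $ j)" for i
      by (simp add: B_def principal_submatrix_def matrix_vector_mult_def)
    ultimately have "(B *v x) $ i = (if i \<in> S then (A *v x) $ i else 0)" for i
      by (simp only:)
    then show ?thesis
      by (simp add: vec_eq_iff x)
  qed
  have "rank B = card S"
    using A card by (simp add: general_position_def B_def S_def)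
  moreover have "dim U = card S"
    unfolding U_def dim_vec_eq[symmetric] by (rule dim_substandard_cart)
  moreover have "subspace U"
    by (auto simp: U_def subspace_def)
  moreover have "range ((*v) B) \<subseteq> U"
    by (auto simp: U_def B_def principal_submatrix_def matrix_vector_mult_def)
  moreover have "subspace (range ((*v) B))"
    by (intro linear_subspace_image subspace_UNIV matrix_vector_mul_linear)
  ultimately have "range ((*v) B) = U"
    by (intro subspace_dim_equal) (auto simp: rank_dim_range)
  moreover have "x \<in> U"
    by (simp add: U_def S_def)
  ultimately obtain z where "x = B *v z"
    by blast
  then have "x \<bullet> x = z \<bullet> (B *v x)"
    by (metis \<open>transpose B = B\<close> inner_matrix_vector_mult)
  then show ?thesis
    using \<open>B *v x = 0\<close> by simp
qed

lemma strong_pl_rank_le: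
  fixes E :: "'n::finite set set"
  assumes E: "simple_graph E"
  shows "strong_pl_rank E \<le> degeneracy E + 1"
  unfolding strong_pl_rank_def
proof (rule Least_le, intro allI impI)
  fix A :: "real^'n^'n"
  assume A: "pos_semidef A \<and> general_position A \<and> degeneracy E + 1 \<le> rank A"
  show "unique_minimizer E A"
  proof (rule unique_minimizer_if_injective)
    fix \<Omega> assume \<Omega>: "\<Omega> \<in> graph_matrices E" "A ** \<Omega> = 0"
    show "\<Omega> = 0"
    proof (rule ccontr)
      assume "\<Omega> \<noteq> 0"
      then obtain v where v: "column v \<Omega> \<noteq> 0" "card {i. \<Omega> $ i $ v \<noteq> 0} \<le> degeneracy E + 1"
        using graph_matrix_sparse_column[OF E \<Omega>(1)] by blast
      have "A *v column v \<Omega> = 0"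
        unfolding column_matrix_mult[symmetric] \<Omega>(2) by (simp add: column_def vec_eq_iff)
      moreover have "card {i. column v \<Omega> $ i \<noteq> 0} \<le> rank A"
        using v(2) A by (simp add: column_def)
      ultimately show False
        using general_position_null_vector[of A "column v \<Omega>"] A v(1) by blast
    qed
  qed (use A in blast)
qed

subsection \<open>Linearized low-rank completion\<close>

lemma inner_matrix_mult_left:
  fixes A :: "real^'n^'m" and B :: "real^'p^'n"
  shows "(A ** B) \<bullet> C = B \<bullet> (transpose A ** C)"
proof -
  have "(A ** B) \<bullet> C = (\<Sum>i\<in>UNIV. \<Sum>j\<in>UNIV. \<Sum>k\<in>UNIV. A $ i $ k * B $ k $ j * C $ i $ j)"
    by (simp add: inner_vec_def matrix_matrix_mult_def sum_distrib_right)
  also have "\<dots> = (\<Sum>i\<in>UNIV. \<Sum>k\<in>UNIV. \<Sum>j\<in>UNIV. A $ i $ k * B $ k $ j * C $ i $ j)"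
    by (intro sum.cong sum.swap refl)
  also have "\<dots> = (\<Sum>k\<in>UNIV. \<Sum>i\<in>UNIV. \<Sum>j\<in>UNIV. A $ i $ k * B $ k $ j * C $ i $ j)"
    by (rule sum.swap)
  also have "\<dots> = (\<Sum>k\<in>UNIV. \<Sum>j\<in>UNIV. \<Sum>i\<in>UNIV. A $ i $ k * B $ k $ j * C $ i $ j)"
    by (intro sum.cong sum.swap refl)
  also have "\<dots> = B \<bullet> (transpose A ** C)"
    by (simp add: inner_vec_def matrix_matrix_mult_def transpose_def sum_distrib_left mult_ac)
  finally show ?thesis .
qed

lemma inner_transpose: "transpose A \<bullet> transpose B = A \<bullet> B" for A B :: "real^'n^'m"
  by (simp add: inner_vec_def transpose_def) (rule sum.swap)

lemma inner_matrix_mult_right: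
  fixes A :: "real^'n^'m" and B :: "real^'p^'n"
  shows "(A ** B) \<bullet> C = A \<bullet> (C ** transpose B)"
proof -
  have "(A ** B) \<bullet> C = (transpose B ** transpose A) \<bullet> transpose C"
    unfolding matrix_transpose_mul[symmetric] by (rule inner_transpose[symmetric])
  also have "\<dots> = transpose A \<bullet> transpose (C ** transpose B)"
    by (simp add: inner_matrix_mult_left matrix_transpose_mul)
  finally show ?thesis
    by (simp add: inner_transpose)
qed

lemma transpose_add: "transpose (A + B) = transpose A + transpose B"
  and transpose_scaleR: "transpose (c *\<^sub>R A) = c *\<^sub>R transpose A" for A B :: "real^'n^'m"
  by (simp_all add: transpose_def vec_eq_iff)

lemma bounded_linear_transpose: "bounded_linear (transpose :: real^'n^'m \<Rightarrow> real^'m^'n)"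
  by (simp add: linear_conv_bounded_linear[symmetric] linear_iff transpose_add transpose_scaleR)

lemma bounded_bilinear_matrix_mult:
  "bounded_bilinear ((**) :: real^'n^'m \<Rightarrow> real^'p^'n \<Rightarrow> real^'p^'m)"
  unfolding bilinear_conv_bounded_bilinear[symmetric] bilinear_def linear_iff
  by (simp add: matrix_matrix_mult_def vec_eq_iff algebra_simps sum.distrib sum_distrib_left)

lemmas matrix_mult_add_left = bounded_bilinear.add_left[OF bounded_bilinear_matrix_mult]
lemmas matrix_mult_add_right = bounded_bilinear.add_right[OF bounded_bilinear_matrix_mult]
lemmas matrix_mult_scaleR_left = bounded_bilinear.scaleR_left[OF bounded_bilinear_matrix_mult]
lemmas matrix_mult_scaleR_right = bounded_bilinear.scaleR_right[OF bounded_bilinear_matrix_mult]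

lemma linear_graph_projection: "linear (graph_projection E)"
  by (auto simp: linear_iff graph_projection_def vec_eq_iff)

lemmas graph_projection_add = linear_add[OF linear_graph_projection]
lemmas graph_projection_scaleR = linear_scale[OF linear_graph_projection]

lemma graph_projection_in: "transpose M = M \<Longrightarrow> graph_projection E M \<in> graph_matrices E"
  by (auto simp: graph_projection_def graph_matrices_def symmetric_matrices_def transpose_def
      vec_eq_iff insert_commute)

lemma graph_matrices_transpose: "\<Omega> \<in> graph_matrices E \<Longrightarrow> transpose \<Omega> = \<Omega>"
  by (simp add: graph_matrices_def symmetric_matrices_def)

lemma inner_graph_projection:
  "\<Omega> \<in> graph_matrices E \<Longrightarrow> graph_projection E M \<bullet> \<Omega> = M \<bullet> \<Omega>"
  by (auto simp: inner_vec_def graph_projection_def graph_matrices_def intro!: sum.cong)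

definition injective_on_graph :: "'n::finite set set \<Rightarrow> real^'n^'n \<Rightarrow> bool" where
  "injective_on_graph E A \<longleftrightarrow> (\<forall>\<Omega>\<in>graph_matrices E. A ** \<Omega> = 0 \<longrightarrow> \<Omega> = 0)"

text \<open>
  An \<open>r \<times> p\<close> matrix with \<open>r \<le> p\<close> is encoded as a square matrix whose rows outside a
  set of \<open>r\<close> indices vanish.
\<close>

definition keep_rows :: "'m set \<Rightarrow> real^'n^'m \<Rightarrow> real^'n^'m" where
  "keep_rows K X = (\<chi> i j. if i \<in> K then X $ i $ j else 0)"

lemma linear_keep_rows: "linear (keep_rows K)"
  by (auto simp: linear_iff keep_rows_def vec_eq_iff)

lemma keep_rows_idem: "keep_rows K (keep_rows K X) = keep_rows K X"
  by (auto simp: keep_rows_def vec_eq_iff)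

lemma keep_rows_matrix_mult: "keep_rows K X ** A = keep_rows K (X ** A)"
  by (simp add: keep_rows_def matrix_matrix_mult_def vec_eq_iff)

text \<open>The upper bound counts the rows of \<open>Z\<close> that may be nonzero. For the lower
  bound, independence of the rows in \<open>K\<close> makes the row space \<open>V\<close> have
  dimension \<open>card K\<close>, and the Gram matrix is injective on it.\<close>

lemma rank_gram:
  fixes Z :: "real^'n^'n"
  assumes Z: "keep_rows K Z = Z"
    and inj: "\<And>c. (\<And>k. k \<notin> K \<Longrightarrow> c $ k = 0) \<Longrightarrow> transpose Z *v c = 0 \<Longrightarrow> c = 0"
  shows "rank (transpose Z ** Z) = card K"
proof (rule antisym)
  define U where "U = {c :: real^'n. \<forall>k. k \<notin> K \<longrightarrow> c $ k = 0}"
  have U: "subspace U"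
    by (auto simp: U_def subspace_def)
  have "dim U = card K"
    unfolding U_def dim_vec_eq[symmetric] by (rule dim_substandard_cart)
  have ZU: "Z *v x \<in> U" for x
  proof -
    have "keep_rows K Z *v x \<in> U"
      by (auto simp: U_def keep_rows_def matrix_vector_mult_def)
    then show ?thesis
      by (simp add: Z)
  qed
  then have "rank Z \<le> dim U"
    unfolding rank_dim_range by (intro dim_subset) auto
  then show "rank (transpose Z ** Z) \<le> card K"
    using rank_mul_le_right[of "transpose Z" Z] \<open>dim U = card K\<close> by linarith
  define V where "V = (*v) (transpose Z) ` U"
  have V: "subspace V"
    unfolding V_def by (intro linear_subspace_image U matrix_vector_mul_linear)
  have "inj_on ((*v) (transpose Z)) U"
    unfolding linear_injective_on_subspace_0[OF matrix_vector_mul_linear U]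
    using inj by (auto simp: U_def)
  then have "dim V = dim U"
    unfolding V_def by (intro dim_image_eq matrix_vector_mul_linear) (simp add: span_eq_iff[THEN iffD2, OF U])
  have "inj_on ((*v) (transpose Z ** Z)) V"
    unfolding linear_injective_on_subspace_0[OF matrix_vector_mul_linear V]
  proof clarify
    fix v assume "v \<in> V" "(transpose Z ** Z) *v v = 0"
    then have "Z *v v = 0"
      using inj[of "Z *v v"] ZU[of v] by (simp add: U_def matrix_vector_mul_assoc)
    obtain c where "v = transpose Z *v c"
      using \<open>v \<in> V\<close> by (auto simp: V_def)
    then have "v \<bullet> v = c \<bullet> (Z *v v)"
      using inner_matrix_vector_mult[of "transpose Z" c v] by (simp only: transpose_transpose)
    then show "v = 0"
      using \<open>Z *v v = 0\<close> by simp
  qed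
  then have "dim ((*v) (transpose Z ** Z) ` V) = dim V"
    by (intro dim_image_eq matrix_vector_mul_linear) (simp add: span_eq_iff[THEN iffD2, OF V])
  then have "dim V \<le> rank (transpose Z ** Z)"
    unfolding rank_dim_range by (metis dim_subset image_mono subset_UNIV)
  then show "card K \<le> rank (transpose Z ** Z)"
    using \<open>dim V = dim U\<close> \<open>dim U = card K\<close> by simp
qed

lemma graph_matrices_as_tangents:
  assumes X: "keep_rows K X = X" "injective_on_graph E X" and u: "u \<in> graph_matrices E"
  obtains Y where "keep_rows K Y = Y" "u = graph_projection E (transpose X ** Y + transpose Y ** X)"
proof -
  define T where "T Y = graph_projection E (transpose X ** keep_rows K Y + transpose (keep_rows K Y) ** X)"
    for Y
  have "linear T"
    unfolding T_def
    by (simp add: linear_iff linear_add[OF linear_keep_rows] linear_scale[OF linear_keep_rows]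
        transpose_add transpose_scaleR matrix_mult_add_left matrix_mult_add_right
        matrix_mult_scaleR_left matrix_mult_scaleR_right graph_projection_add graph_projection_scaleR
        scaleR_add_right)
  then have sub: "subspace (range T)"
    by (intro linear_subspace_image subspace_UNIV)
  have TS: "range T \<subseteq> graph_matrices E"
    by (auto simp: T_def transpose_add matrix_transpose_mul intro!: graph_projection_in add.commute)
  have "graph_matrices E \<subseteq> range T"
  proof (rule ccontr)
    assume "\<not> graph_matrices E \<subseteq> range T"
    then have "span (range T) \<subset> span (graph_matrices E)"
      using TS unfolding span_eq_iff[THEN iffD2, OF sub] span_eq_iff[THEN iffD2, OF subspace_graph_matrices]
      by blast
    then obtain \<Omega> where "\<Omega> \<noteq> 0" "\<Omega> \<in> span (graph_matrices E)"
        and orth: "\<And>y. y \<in> span (range T) \<Longrightarrow> orthogonal \<Omega> y"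
      using orthogonal_to_subspace_exists_gen by blast
    then have \<Omega>: "\<Omega> \<in> graph_matrices E"
      unfolding span_eq_iff[THEN iffD2, OF subspace_graph_matrices] by blast
    \<comment> \<open>The tangent in this direction pairs with \<open>\<Omega>\<close> to twice the
      squared norm of \<open>X ** \<Omega>\<close>, so orthogonality to all tangents forces
      \<open>X ** \<Omega> = 0\<close>.\<close>
    define Y where "Y = X ** \<Omega>"
    have Y: "keep_rows K Y = Y"
      using keep_rows_matrix_mult[of K X \<Omega>] X(1) by (simp add: Y_def)
    have "(transpose X ** Y) \<bullet> \<Omega> = Y \<bullet> Y"
      by (simp add: inner_matrix_mult_left Y_def)
    moreover have "(transpose Y ** X) \<bullet> \<Omega> = (transpose X ** Y) \<bullet> \<Omega>"
      using inner_transpose[of "transpose X ** Y" \<Omega>] graph_matrices_transpose[OF \<Omega>]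
      by (simp add: matrix_transpose_mul)
    moreover have "\<Omega> \<bullet> T Y = 0"
      using orth[of "T Y"] by (simp add: orthogonal_def span_base)
    ultimately have "Y = 0"
      using Y by (simp add: T_def inner_commute[of \<Omega>] inner_graph_projection[OF \<Omega>] inner_add_left)
    then show False
      using X(2) \<Omega> \<open>\<Omega> \<noteq> 0\<close> by (auto simp: injective_on_graph_def Y_def)
  qed
  then obtain Y where "u = T Y"
    using u by blast
  then show ?thesis
    using that[of "keep_rows K Y"] by (simp add: T_def keep_rows_idem)
qed

text \<open>Let \<open>P\<close> vanish on the image, and let \<open>u\<close> be a direction in
  which its lowest order term at the projected Gram matrix of \<open>X\<close> is nonzero. Some
  \<open>Y\<close> has \<open>u\<close> as its tangent, so the projected Gram matrices of
  \<open>X + t *\<^sub>R Y\<close> leave the base point in directions tending to \<open>u\<close>.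
  Independent rows keep their rank equal to \<open>card K\<close> for small \<open>t\<close>, so
  \<open>P\<close> vanishes on them, and the limit contradicts the choice of
  \<open>u\<close>.\<close>

lemma zariski_dense_if_injective:
  fixes E :: "'n::finite set set"
  assumes X: "keep_rows K X = X" "injective_on_graph E X"
    and rows: "\<And>c. (\<And>k. k \<notin> K \<Longrightarrow> c $ k = 0) \<Longrightarrow> transpose X *v c = 0 \<Longrightarrow> c = 0"
  shows "zariski_dense_in (graph_projection E ` {\<Omega> \<in> symmetric_matrices. rank \<Omega> = card K}) (graph_matrices E)"
    (is "zariski_dense_in ?T ?S")
  unfolding zariski_dense_in_def
proof (intro conjI allI impI ballI)
  show "?T \<subseteq> ?S"
    by (auto simp: symmetric_matrices_def intro: graph_projection_in)
next
  fix P y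
  assume P: "real_polynomial_function P \<and> (\<forall>x\<in>?T. P x = 0)" and y: "y \<in> ?S"
  define y0 where "y0 = graph_projection E (transpose X ** X)"
  have "y0 \<in> ?S"
    unfolding y0_def by (intro graph_projection_in) (simp add: matrix_transpose_mul)
  obtain n G where G: "\<And>j. real_polynomial_function (G j)" "\<And>j u. j > n \<Longrightarrow> G j u = 0"
      and exp: "\<And>t u. P (y0 + t *\<^sub>R u) = (\<Sum>j\<le>n. t ^ j * G j u)"
    using real_polynomial_function_expand[of P y0] P by blast
  show "P y = 0"
  proof (rule ccontr)
    assume "P y \<noteq> 0"
    then have "(\<Sum>j\<le>n. G j (y - y0)) \<noteq> 0"
      using exp[of 1 "y - y0"] by simp
    then obtain j where "G j (y - y0) \<noteq> 0"
      by (meson sum.neutral)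
    moreover have "y - y0 \<in> ?S"
      using y \<open>y0 \<in> ?S\<close> by (intro subspace_diff subspace_graph_matrices)
    ultimately have ex: "\<exists>j. \<exists>u\<in>?S. G j u \<noteq> 0"
      by blast
    define s where "s = (LEAST j. \<exists>u\<in>?S. G j u \<noteq> 0)"
    obtain u where u: "u \<in> ?S" "G s u \<noteq> 0"
      using LeastI_ex[OF ex] unfolding s_def by blast
    have low: "G j v = 0" if "j < s" "v \<in> ?S" for j v
      using not_less_Least[OF that(1)[unfolded s_def]] that(2) by blast
    have "s \<le> n"
      using u G(2) by (meson not_le)
    obtain Y where Y: "keep_rows K Y = Y" "u = graph_projection E (transpose X ** Y + transpose Y ** X)"
      using graph_matrices_as_tangents[OF X u(1)] .
    \<comment> \<open>The difference quotient of the curve at the base point; the Gram matrix is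
      quadratic, so only one correction term appears.\<close>
    define z where "z t = u + t *\<^sub>R graph_projection E (transpose Y ** Y)" for t
    define Z where "Z t = X + t *\<^sub>R Y" for t
    have "(z \<longlongrightarrow> u + 0 *\<^sub>R graph_projection E (transpose Y ** Y)) (at 0)"
      unfolding z_def by (intro tendsto_intros)
    then have lim: "(z \<longlongrightarrow> u) (at 0)"
      by simp
    have zS: "z t \<in> ?S" for t
      unfolding z_def using u(1)
      by (intro subspace_add subspace_scale subspace_graph_matrices graph_projection_in)
         (simp_all add: matrix_transpose_mul)
    have yz: "y0 + t *\<^sub>R z t = graph_projection E (transpose (Z t) ** Z t)" for t
      by (simp add: y0_def z_def Z_def Y(2) transpose_add transpose_scaleR matrix_mult_add_left
          matrix_mult_add_right matrix_mult_scaleR_left matrix_mult_scaleR_right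
          graph_projection_add graph_projection_scaleR algebra_simps)
    define U where "U = {c :: real^'n. \<forall>k. k \<notin> K \<longrightarrow> c $ k = 0}"
    have U: "subspace U"
      by (auto simp: U_def subspace_def)
    have "\<forall>\<^sub>F t in at 0. rank (transpose (Z t) ** Z t) = card K"
    proof -
      have J: "transpose (Z t) *v c = transpose X *v c + t *\<^sub>R (transpose Y *v c)" for t c
        by (simp add: Z_def transpose_add transpose_scaleR matrix_vector_mult_add_rdistrib
            scaleR_matrix_vector_assoc del: transpose_matrix_vector)
      have lim: "((\<lambda>t. transpose (Z t) *v c) \<longlongrightarrow> transpose (Z 0) *v c) (at 0)" for c
        unfolding J by (intro tendsto_intros)
      have inj: "c = 0" if "c \<in> U" "transpose (Z 0) *v c = 0" for c
        using rows[of c] that by (simp add: U_def Z_def)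
      obtain e where e: "e > 0" "\<forall>\<^sub>F t in at 0. \<forall>c\<in>U. e * norm c \<le> norm (transpose (Z t) *v c)"
        by (rule eventually_uniformly_injective[OF matrix_vector_mul_linear lim U inj])
      show ?thesis
        using e(2)
      proof eventually_elim
        case (elim t)
        show ?case
        proof (rule rank_gram)
          show "keep_rows K (Z t) = Z t"
            using X(1) Y(1)
            by (simp add: Z_def linear_add[OF linear_keep_rows] linear_scale[OF linear_keep_rows])
          fix c :: "real^'n"
          assume "\<And>k. k \<notin> K \<Longrightarrow> c $ k = 0" "transpose (Z t) *v c = 0"
          then have "e * norm c \<le> 0"
            using elim by (force simp: U_def)
          then show "c = 0"
            using e(1) by (simp add: mult_le_0_iff)
        qed
      qed
    qed
    then have vanish: "\<forall>\<^sub>F t in at 0. (\<Sum>j\<le>n. t ^ j * G j (z t)) = 0"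
    proof eventually_elim
      case (elim t)
      then have "y0 + t *\<^sub>R z t \<in> ?T"
        unfolding yz by (auto simp: symmetric_matrices_def matrix_transpose_mul)
      then show ?case
        unfolding exp[symmetric] using P by blast
    qed
    have "G s u = 0"
    proof (rule leading_coefficient_limit[where H = G, OF _ lim vanish])
      show "isCont (G j) u" for j
        using G(1) by (rule continuous_real_polymonial_function)
    qed (use low zS \<open>s \<le> n\<close> in auto)
    then show False
      using u(2) by blast
  qed
qed

subsection \<open>Generic completion of rank degeneracy plus one\<close>

text \<open>The numbering \<open>h\<close> supplies both the nodes and the exponents, and the kept
  rows say that the moments of \<open>x\<close> below order \<open>r\<close> vanish. Testing
  \<open>x\<close> with the polynomial of degree below \<open>r\<close> whose roots are all support
  nodes but one isolates the remaining entry.\<close>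

lemma moment_curve_columns_independent:
  fixes h :: "'n::finite \<Rightarrow> nat"
  assumes h: "bij_betw h UNIV {..<CARD('n)}" and "r \<le> CARD('n)"
    and card: "card {i. x $ i \<noteq> 0} \<le> r"
    and x: "keep_rows {k. h k < r} (\<chi> k i. real (h i) ^ h k) *v x = 0"
  shows "x = 0"
proof (rule ccontr)
  assume "x \<noteq> 0"
  then obtain m where m: "x $ m \<noteq> 0"
    by (auto simp: vec_eq_iff)
  define S where "S = {i. x $ i \<noteq> 0} - {m}"
  define q :: "real poly" where "q = (\<Prod>i\<in>S. [:- real (h i), 1:])"
  have "card S < card {i. x $ i \<noteq> 0}"
    using m by (intro psubset_card_mono) (auto simp: S_def)
  then have "card S < r"
    using card by linarith
  moreover have "degree q \<le> card S"
    using degree_prod_sum_le[of S "\<lambda>i. [:- real (h i), 1:]"] by (simp add: q_def)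
  ultimately have "degree q < r" by simp
  have moment: "(\<Sum>i\<in>UNIV. x $ i * real (h i) ^ j) = 0" if "j < r" for j
  proof -
    have "j \<in> h ` UNIV"
      using h that \<open>r \<le> CARD('n)\<close> by (simp add: bij_betw_def)
    then obtain k where "h k = j" by blast
    moreover have "(keep_rows {k. h k < r} (\<chi> k i. real (h i) ^ h k) *v x) $ k = 0"
      by (simp add: x)
    ultimately show ?thesis
      using that by (simp add: keep_rows_def matrix_vector_mult_def mult.commute)
  qed
  have "(\<Sum>i\<in>UNIV. x $ i * poly q (real (h i))) = (\<Sum>j\<le>degree q. coeff q j * (\<Sum>i\<in>UNIV. x $ i * real (h i) ^ j))"
    unfolding poly_altdef sum_distrib_left by (subst sum.swap) (simp add: mult_ac)
  also have "\<dots> = 0"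
    using moment \<open>degree q < r\<close> by simp
  finally have "0 = (\<Sum>i\<in>UNIV. x $ i * poly q (real (h i)))" by simp
  also have "\<dots> = (\<Sum>i\<in>UNIV. if i = m then x $ m * poly q (real (h m)) else 0)"
  proof (intro sum.cong refl)
    fix i
    have "poly q (real (h i)) = 0" if "i \<in> S"
      using that by (auto simp: q_def poly_prod)
    then show "x $ i * poly q (real (h i)) = (if i = m then x $ m * poly q (real (h m)) else 0)"
      by (cases "i \<in> S") (auto simp: S_def)
  qed
  also have "\<dots> = x $ m * poly q (real (h m))"
    by simp
  finally have "poly q (real (h m)) = 0"
    using m by simp
  then obtain i where "i \<in> S" "h i = h m"
    by (auto simp: q_def poly_prod)
  then show False
    using bij_betw_imp_inj_on[OF h] by (auto simp: S_def inj_on_def)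
qed

text \<open>A dependency between rows is a polynomial of degree below \<open>CARD('n)\<close> that
  vanishes at \<open>CARD('n)\<close> distinct nodes.\<close>

lemma moment_curve_rows_independent:
  fixes h :: "'n::finite \<Rightarrow> nat"
  assumes h: "bij_betw h UNIV {..<CARD('n)}" and c0: "\<And>k. k \<notin> K \<Longrightarrow> c $ k = 0"
    and c: "transpose (keep_rows K (\<chi> k i. real (h i) ^ h k)) *v c = 0"
  shows "c = 0"
proof -
  define q where "q = (\<Sum>k\<in>UNIV. monom (c $ k) (h k))"
  have hlt: "h k < CARD('n)" for k
    using h by (auto simp: bij_betw_def)
  have inj: "inj h"
    using h by (auto simp: bij_betw_def)
  have "poly q (real (h i)) = 0" for i
  proof -
    have "0 = (transpose (keep_rows K (\<chi> k i. real (h i) ^ h k)) *v c) $ i"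
      unfolding c by simp
    also have "\<dots> = (\<Sum>k\<in>UNIV. (if k \<in> K then real (h i) ^ h k else 0) * c $ k)"
      unfolding matrix_vector_mult_def transpose_def keep_rows_def by (simp cong: if_cong)
    also have "\<dots> = (\<Sum>k\<in>UNIV. c $ k * real (h i) ^ h k)"
      by (intro sum.cong) (auto simp: c0)
    also have "\<dots> = poly q (real (h i))"
      by (simp add: q_def poly_sum poly_monom)
    finally show ?thesis by simp
  qed
  then have "(\<lambda>i. real (h i)) ` UNIV \<subseteq> {t. poly q t = 0}"
    by auto
  moreover have "card ((\<lambda>i. real (h i)) ` UNIV) = CARD('n)"
    using inj by (intro card_image) (auto simp: inj_on_def)
  moreover have "degree q < CARD('n)"
    unfolding q_def by (intro degree_sum_less le_less_trans[OF degree_monom_le hlt]) simp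
  ultimately have "q = 0"
    by (metis card_mono card_poly_roots_bound less_le_trans not_le poly_roots_finite)
  have "c $ k = 0" for k
  proof -
    have "coeff q (h k) = (\<Sum>l\<in>UNIV. if l = k then c $ k else 0)"
      unfolding q_def coeff_sum using inj by (intro sum.cong) (auto simp: inj_eq)
    then show ?thesis
      using \<open>q = 0\<close> by simp
  qed
  then show ?thesis
    by (simp add: vec_eq_iff)
qed

lemma zariski_dense_degeneracy:
  fixes E :: "'n::finite set set"
  assumes E: "simple_graph E"
  shows "zariski_dense_in (graph_projection E ` {\<Omega> \<in> symmetric_matrices. rank \<Omega> = degeneracy E + 1})
           (graph_matrices E)"
proof -
  define r where "r = degeneracy E + 1"
  have r: "r \<le> CARD('n)"
    using degeneracy_less_card[OF E] by (simp add: r_def)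
  obtain h :: "'n \<Rightarrow> nat" where h: "bij_betw h UNIV {..<CARD('n)}"
    using ex_bij_betw_finite_nat[of "UNIV :: 'n set"] by (auto simp: atLeast0LessThan)
  define K where "K = {k. h k < r}"
  have "h ` K = {..<r}"
  proof (intro equalityI subsetI)
    fix j assume "j \<in> {..<r}"
    then have "j \<in> h ` UNIV"
      using h r by (simp add: bij_betw_def)
    then show "j \<in> h ` K"
      using \<open>j \<in> {..<r}\<close> by (auto simp: K_def)
  qed (auto simp: K_def)
  then have "card K = r"
    using card_image[OF inj_on_subset[OF bij_betw_imp_inj_on[OF h] subset_UNIV], of K] by simp
  define X :: "real^'n^'n" where "X = keep_rows K (\<chi> k i. real (h i) ^ h k)"
  have "injective_on_graph E X"
    unfolding injective_on_graph_def
  proof (intro ballI impI, rule ccontr)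
    fix \<Omega> assume \<Omega>: "\<Omega> \<in> graph_matrices E" "X ** \<Omega> = 0" "\<Omega> \<noteq> 0"
    obtain v where v: "column v \<Omega> \<noteq> 0" "card {i. \<Omega> $ i $ v \<noteq> 0} \<le> r"
      using graph_matrix_sparse_column[OF E \<Omega>(1,3)] by (auto simp: r_def)
    have "X *v column v \<Omega> = 0"
      unfolding column_matrix_mult[symmetric] \<Omega>(2) by (simp add: column_def vec_eq_iff)
    moreover have "card {i. column v \<Omega> $ i \<noteq> 0} \<le> r"
      using v(2) by (simp add: column_def)
    ultimately show False
      using moment_curve_columns_independent[OF h r] v(1) by (simp add: X_def K_def)
  qed
  then have "zariski_dense_in (graph_projection E ` {\<Omega> \<in> symmetric_matrices. rank \<Omega> = card K})
      (graph_matrices E)"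
    using moment_curve_rows_independent[OF h, of K]
    by (intro zariski_dense_if_injective[of K X]) (auto simp: X_def keep_rows_idem)
  then show ?thesis
    by (simp add: \<open>card K = r\<close> r_def)
qed

lemma generic_completion_rank_le:
  "simple_graph E \<Longrightarrow> generic_completion_rank E \<le> degeneracy E + 1"
  unfolding generic_completion_rank_def by (intro Least_le zariski_dense_degeneracy)

text \<open>The least rank is attained because \<open>degeneracy E + 1\<close> is an admissible
  one.\<close>

lemma zariski_dense_generic_completion_rank:
  "simple_graph E \<Longrightarrow>
   zariski_dense_in (graph_projection E ` {\<Omega> \<in> symmetric_matrices. rank \<Omega> = generic_completion_rank E})
     (graph_matrices E)"
  unfolding generic_completion_rank_def
  by (rule LeastI[where P = "\<lambda>l. zariski_dense_in (_ ` {\<Omega> \<in> _. _ \<Omega> = l}) _"]) (rule zariski_dense_degeneracy)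

subsection \<open>Almost every matrix\<close>

text \<open>Fubini, one coordinate at a time. With coordinate \<open>i\<close> frozen at
  \<open>X0 i\<close>, the induction hypothesis makes \<open>Q\<close> nonzero for almost all
  remaining coordinates; for each of these the polynomial in coordinate \<open>i\<close> is not
  identically zero and has finitely many roots.\<close>

lemma AE_polynomial_nonzero:
  fixes Q :: "('i \<Rightarrow> real) \<Rightarrow> real"
  assumes "finite I" "Q \<in> borel_measurable (Pi\<^sub>M I (\<lambda>_. lborel))"
    and "\<And>X i. real_polynomial_function (\<lambda>t. Q (X(i := t)))"
    and "X0 \<in> extensional I" "Q X0 \<noteq> 0"
  shows "AE X in Pi\<^sub>M I (\<lambda>_. lborel). Q X \<noteq> 0"
  using assms
proof (induction I arbitrary: Q X0 rule: finite_induct)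
  case empty
  then show ?case
    by (intro AE_I2) (simp add: space_PiM_empty)
next
  case (insert i I)
  interpret product_sigma_finite "\<lambda>_. lborel :: real measure"
    by standard
  \<comment> \<open>Indicator of the zero set, whose integral is to be shown to be 0.\<close>
  define u where "u X = (if Q X = 0 then 1 else 0 :: ennreal)" for X
  have [measurable]: "Q \<in> borel_measurable (Pi\<^sub>M (insert i I) (\<lambda>_. lborel))"
    by (rule insert.prems)
  have u: "u \<in> borel_measurable (Pi\<^sub>M (insert i I) (\<lambda>_. lborel))"
    unfolding u_def by measurable
  have "AE Z in Pi\<^sub>M I (\<lambda>_. lborel). Q (Z(i := X0 i)) \<noteq> 0"
  proof (rule insert.IH)
    have "(\<lambda>Z. Z(i := X0 i)) \<in> measurable (Pi\<^sub>M I (\<lambda>_. lborel)) (Pi\<^sub>M (insert i I) (\<lambda>_. lborel))"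
      using measurable_compose[OF _ measurable_add_dim, of "\<lambda>Z. (Z, X0 i)"] by simp
    then show "(\<lambda>Z. Q (Z(i := X0 i))) \<in> borel_measurable (Pi\<^sub>M I (\<lambda>_. lborel))"
      by measurable
    show "real_polynomial_function (\<lambda>t. Q ((X(j := t))(i := X0 i)))" for X j
    proof (cases "j = i")
      case True
      then show ?thesis
        by (simp add: real_polynomial_function.intros(2))
    next
      case False
      then have "(X(j := t))(i := X0 i) = (X(i := X0 i))(j := t)" for t
        by (rule fun_upd_twist)
      then show ?thesis
        using insert.prems(2) by (simp only:)
    qed
    have "(restrict X0 I)(i := X0 i) = X0"
      using insert.prems(3) by (auto simp: extensional_def restrict_def fun_eq_iff)
    then show "Q ((restrict X0 I)(i := X0 i)) \<noteq> 0"
      using insert.prems by simp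
  qed (rule restrict_extensional)
  then have "AE Z in Pi\<^sub>M I (\<lambda>_. lborel). (\<integral>\<^sup>+ t. u (Z(i := t)) \<partial>lborel) = 0"
  proof eventually_elim
    case (elim Z)
    obtain N where "degree_on_lines_le N (\<lambda>t. Q (Z(i := t)))"
      using real_polynomial_function_degree_on_lines[OF insert.prems(2)] by blast
    then obtain p where p: "\<And>t. Q (Z(i := 0 + t *\<^sub>R 1)) = poly p t"
      unfolding degree_on_lines_le_def by blast
    then have "p \<noteq> 0"
      using elim p[of "X0 i"] by auto
    then have "AE t in lborel. t \<notin> {t. poly p t = 0}"
      by (intro AE_not_in finite_imp_null_set_lborel poly_roots_finite)
    then have "AE t in lborel. u (Z(i := t)) = 0"
      by eventually_elim (use p in \<open>simp add: u_def\<close>)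
    then have "(\<integral>\<^sup>+ t. u (Z(i := t)) \<partial>lborel) = (\<integral>\<^sup>+ (t :: real). 0 \<partial>lborel)"
      by (intro nn_integral_cong_AE) simp
    then show ?case by simp
  qed
  then have "(\<integral>\<^sup>+ Z. (\<integral>\<^sup>+ t. u (Z(i := t)) \<partial>lborel) \<partial>Pi\<^sub>M I (\<lambda>_. lborel)) = (\<integral>\<^sup>+ (Z :: 'i \<Rightarrow> real). 0 \<partial>Pi\<^sub>M I (\<lambda>_. lborel))"
    by (intro nn_integral_cong_AE) simp
  then have "integral\<^sup>N (Pi\<^sub>M (insert i I) (\<lambda>_. lborel)) u = 0"
    using product_nn_integral_insert[OF insert.hyps u] by simp
  then have "AE X in Pi\<^sub>M (insert i I) (\<lambda>_. lborel). u X = 0"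
    using nn_integral_0_iff_AE[OF u] by simp
  then show ?case
    by eventually_elim (auto simp: u_def split: if_splits)
qed

section \<open>Injectivity as the nonvanishing of a determinant\<close>

lemma polynomial_function_matrix:
  fixes F :: "'a::real_normed_vector \<Rightarrow> real^'n^'m"
  assumes "\<And>i j. real_polynomial_function (\<lambda>x. F x $ i $ j)"
  shows "polynomial_function F"
  unfolding polynomial_function_iff_Basis_inner
  by (auto simp: Basis_vec_def inner_axis assms)

text \<open>Flattens a matrix, so that a linear endomorphism of the matrix space becomes a square
  matrix and has a \<open>det\<close>.\<close>

definition entry_vector :: "real^'n^'m \<Rightarrow> real^('m \<times> 'n)" where
  "entry_vector A = (\<chi> a. A $ fst a $ snd a)"

lemma entry_vector_matrix:
  fixes F :: "real^'n^'m \<Rightarrow> real^'n^'m"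
  assumes "linear F"
  shows "(\<chi> a b. entry_vector (F (axis (fst b) (axis (snd b) 1))) $ a) *v entry_vector \<Omega> = entry_vector (F \<Omega>)"
proof -
  define e where "e b = (axis (fst b) (axis (snd b) 1) :: real^'n^'m)" for b
  have "\<Omega> = (\<Sum>b\<in>UNIV. entry_vector \<Omega> $ b *\<^sub>R e b)"
  proof -
    have "(\<Sum>b\<in>UNIV. entry_vector \<Omega> $ b *\<^sub>R e b) $ i $ j = \<Omega> $ i $ j" for i j
    proof -
      have "(\<Sum>b\<in>UNIV. entry_vector \<Omega> $ b *\<^sub>R e b) $ i $ j =
          (\<Sum>b\<in>UNIV. if b = (i, j) then \<Omega> $ i $ j else 0)"
        unfolding sum_component
        by (intro sum.cong) (auto simp: entry_vector_def e_def axis_def)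
      then show ?thesis by simp
    qed
    then show ?thesis
      by (simp add: vec_eq_iff)
  qed
  then have "F \<Omega> = (\<Sum>b\<in>UNIV. entry_vector \<Omega> $ b *\<^sub>R F (e b))"
    by (metis (no_types, lifting) assms linear_scale linear_sum sum.cong)
  then show ?thesis
    by (simp add: vec_eq_iff matrix_vector_mult_def e_def[symmetric] entry_vector_def mult.commute)
qed

lemma injective_on_graph_polynomial:
  fixes A0 :: "real^'n^'n"
  assumes "injective_on_graph E A0"
  obtains \<psi> where "real_polynomial_function \<psi>" "\<psi> A0 \<noteq> 0"
    "\<And>A. \<psi> A \<noteq> 0 \<Longrightarrow> injective_on_graph E A"
proof -
  let ?S = "graph_matrices E"
  define \<sigma> where "\<sigma> \<Omega> = graph_projection E ((1/2) *\<^sub>R (\<Omega> + transpose \<Omega>))" for \<Omega>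
  have \<sigma>_lin: "linear \<sigma>"
    unfolding \<sigma>_def by (simp add: linear_iff transpose_add transpose_scaleR graph_projection_add
        graph_projection_scaleR algebra_simps)
  have \<sigma>_in: "\<sigma> \<Omega> \<in> ?S" for \<Omega>
    unfolding \<sigma>_def by (intro graph_projection_in) (simp add: transpose_add transpose_scaleR add.commute)
  have \<sigma>_id: "\<sigma> \<Omega> = \<Omega>" if "\<Omega> \<in> ?S" for \<Omega>
    unfolding \<sigma>_def using that graph_matrices_transpose[OF that]
    by (auto simp: graph_projection_def graph_matrices_def vec_eq_iff scaleR_2[symmetric])
  have mult_lin: "linear ((**) A0)"
    by (intro bounded_linear.linear bounded_bilinear.bounded_linear_right[OF bounded_bilinear_matrix_mult])
  have "inj_on ((**) A0) ?S"
    unfolding linear_injective_on_subspace_0[OF mult_lin subspace_graph_matrices]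
    using assms by (simp add: injective_on_graph_def)
  then obtain L where L: "linear L" "\<And>\<Omega>. \<Omega> \<in> ?S \<Longrightarrow> L (A0 ** \<Omega>) = \<Omega>"
    using linear_exists_left_inverse_on[OF mult_lin subspace_graph_matrices] by blast
  \<comment> \<open>Extends the restricted map to an endomorphism of the whole matrix space:
    \<open>\<sigma>\<close> projects onto \<open>graph_matrices E\<close> and \<open>L\<close>
    undoes multiplication by \<open>A0\<close> there. Thus \<open>F A0\<close> is the identity,
    \<open>F A\<close> depends affinely on \<open>A\<close>, and a graph matrix killed by
    \<open>A\<close> is killed by \<open>F A\<close>.\<close>
  define F where "F A \<Omega> = L (A ** \<sigma> \<Omega>) + (\<Omega> - \<sigma> \<Omega>)" for A \<Omega>
  have F_lin: "linear (F A)" for A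
    unfolding F_def linear_iff
    by (simp add: linear_add[OF \<sigma>_lin] linear_scale[OF \<sigma>_lin] linear_add[OF L(1)] linear_scale[OF L(1)]
        matrix_mult_add_right matrix_mult_scaleR_right algebra_simps)
  define M :: "real^'n^'n \<Rightarrow> real^('n \<times> 'n)^('n \<times> 'n)"
    where "M A = (\<chi> a b. entry_vector (F A (axis (fst b) (axis (snd b) 1))) $ a)" for A
  have MF: "M A *v entry_vector \<Omega> = entry_vector (F A \<Omega>)" for A \<Omega>
    unfolding M_def by (rule entry_vector_matrix[OF F_lin])
  have "real_polynomial_function (\<lambda>A. M A $ a $ b)" for a b
  proof -
    define U where "U = \<sigma> (axis (fst b) (axis (snd b) 1))"
    define c where "c = (axis (fst b) (axis (snd b) 1) - U) $ fst a $ snd a"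
    have "bounded_linear (\<lambda>A. L (A ** U) $ fst a $ snd a)"
      using bounded_linear_compose[OF bounded_linear_vec_nth[of "snd a"]
          bounded_linear_compose[OF bounded_linear_vec_nth[of "fst a"]
            bounded_linear_compose[OF L(1)[unfolded linear_conv_bounded_linear]
              bounded_bilinear.bounded_linear_left[OF bounded_bilinear_matrix_mult]]]] .
    then have "real_polynomial_function (\<lambda>A. L (A ** U) $ fst a $ snd a + c)"
      by (intro real_polynomial_function.intros(1-3))
    then show ?thesis
      by (simp add: M_def entry_vector_def F_def c_def U_def)
  qed
  then have "real_polynomial_function (\<lambda>A. det (M A))"
    unfolding det_def
    by (intro real_polynomial_function_sum real_polynomial_function.intros(4)[OF real_polynomial_function.intros(2)]
        real_polynomial_function_prod finite_permutations) auto
  moreover have "det (M A0) \<noteq> 0"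
  proof -
    have "M A0 *v v = v" for v
    proof -
      have "v = entry_vector (\<chi> i j. v $ (i, j))"
        by (simp add: entry_vector_def)
      moreover have "F A0 \<Omega> = \<Omega>" for \<Omega>
        by (simp add: F_def L(2) \<sigma>_in)
      ultimately show ?thesis
        by (metis MF)
    qed
    then have "M A0 = mat 1"
      by (simp add: matrix_eq)
    then show ?thesis
      by simp
  qed
  moreover have "injective_on_graph E A" if "det (M A) \<noteq> 0" for A
    unfolding injective_on_graph_def
  proof (intro ballI impI)
    fix \<Omega> assume \<Omega>: "\<Omega> \<in> ?S" "A ** \<Omega> = 0"
    have "F A \<Omega> = 0"
      using \<Omega> by (simp add: F_def \<sigma>_id linear_0[OF L(1)])
    then have "M A *v entry_vector \<Omega> = entry_vector 0"
      by (simp only: MF)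
    also have "\<dots> = 0"
      by (simp add: entry_vector_def vec_eq_iff)
    finally have "M A *v entry_vector \<Omega> = 0" .
    then have "entry_vector \<Omega> = 0"
      using that invertible_det_nz[of "M A"] invertible_left_inverse matrix_left_invertible_ker by blast
    then show "\<Omega> = 0"
      by (simp add: entry_vector_def vec_eq_iff)
  qed
  ultimately show ?thesis
    using that by blast
qed

lemma AE_injective_on_graph:
  fixes E :: "'n::finite set set"
  assumes X0: "injective_on_graph E (gram r X0)"
  shows "AE X in lebesgue_rows r. injective_on_graph E (gram r X)"
proof -
  define I where "I = {..<r} \<times> (UNIV :: 'n set)"
  obtain \<psi> where \<psi>: "real_polynomial_function \<psi>" "\<psi> (gram r X0) \<noteq> 0"
      "\<And>A. \<psi> A \<noteq> 0 \<Longrightarrow> injective_on_graph E A"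
    using injective_on_graph_polynomial[OF X0] by blast
  have "AE X in Pi\<^sub>M I (\<lambda>_. lborel). \<psi> (gram r X) \<noteq> 0"
  proof (rule AE_polynomial_nonzero)
    show "finite I"
      by (simp add: I_def)
    have comp: "(\<lambda>X. X (k, i)) \<in> borel_measurable (Pi\<^sub>M I (\<lambda>_. lborel))" if "k < r" for k i
      using measurable_component_singleton[of "(k, i)" I "\<lambda>_. lborel"] that by (simp add: I_def)
    have "gram r \<in> borel_measurable (Pi\<^sub>M I (\<lambda>_. lborel))"
      unfolding borel_measurable_euclidean_space[of "gram r"]
      by (auto simp: Basis_vec_def inner_axis gram_def intro!: borel_measurable_sum borel_measurable_times comp)
    then show "(\<lambda>X. \<psi> (gram r X)) \<in> borel_measurable (Pi\<^sub>M I (\<lambda>_. lborel))"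
      by (rule measurable_compose)
         (intro borel_measurable_continuous_onI continuous_at_imp_continuous_on ballI
           continuous_real_polymonial_function \<psi>(1))
    show "real_polynomial_function (\<lambda>t. \<psi> (gram r (X(i := t))))" for X i
    proof -
      have coord: "real_polynomial_function (\<lambda>t. (X(i := t)) j)" for j
        by (cases "j = i")
           (simp_all add: real_polynomial_function.intros(1)[OF bounded_linear_ident] real_polynomial_function.intros(2))
      have "polynomial_function (\<lambda>t. gram r (X(i := t)))"
        by (rule polynomial_function_matrix)
           (auto simp: gram_def simp del: fun_upd_apply intro!: real_polynomial_function_sum real_polynomial_function.intros(4) coord)
      from real_polynomial_function_compose[OF this \<psi>(1)] show ?thesis
        by (simp add: o_def)
    qed
    show "restrict X0 I \<in> extensional I"
      by simp
    have "gram r (restrict X0 I) = gram r X0"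
      by (simp add: gram_def I_def)
    then show "\<psi> (gram r (restrict X0 I)) \<noteq> 0"
      using \<psi>(2) by simp
  qed
  then show ?thesis
    unfolding lebesgue_rows_def I_def by eventually_elim (rule \<psi>(3))
qed

subsection \<open>From Zariski density to injectivity\<close>

lemma polynomial_function_bilinear:
  fixes f :: "'a::real_normed_vector \<Rightarrow> 'b::euclidean_space" and g :: "'a \<Rightarrow> 'c::euclidean_space"
    and B :: "'b \<Rightarrow> 'c \<Rightarrow> 'd::euclidean_space"
  assumes B: "bounded_bilinear B" and "polynomial_function f" "polynomial_function g"
  shows "polynomial_function (\<lambda>x. B (f x) (g x))"
proof -
  have "B (f x) (g x) = (\<Sum>i\<in>Basis. \<Sum>j\<in>Basis. ((f x \<bullet> i) * (g x \<bullet> j)) *\<^sub>R B i j)" for x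
  proof -
    have "B (f x) (g x) = B (\<Sum>i\<in>Basis. (f x \<bullet> i) *\<^sub>R i) (\<Sum>j\<in>Basis. (g x \<bullet> j) *\<^sub>R j)"
      by (simp add: euclidean_representation)
    also have "\<dots> = (\<Sum>i\<in>Basis. \<Sum>j\<in>Basis. ((f x \<bullet> i) * (g x \<bullet> j)) *\<^sub>R B i j)"
      by (simp only: bounded_bilinear.sum_left[OF B] bounded_bilinear.scaleR_left[OF B])
         (simp only: bounded_bilinear.sum_right[OF B] bounded_bilinear.scaleR_right[OF B]
           scaleR_sum_right scaleR_scaleR)
    finally show ?thesis .
  qed
  moreover have "polynomial_function (\<lambda>x. (f x \<bullet> i) * (g x \<bullet> j))" for i j
    using polynomial_function_mult[of "\<lambda>x. f x \<bullet> i" "\<lambda>x. g x \<bullet> j"] assms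
    by (simp add: polynomial_function_inner)
  ultimately show ?thesis
    by (auto intro!: polynomial_function_sum polynomial_function_mult)
qed

lemma polynomial_function_linear_comp:
  "bounded_linear h \<Longrightarrow> polynomial_function f \<Longrightarrow> polynomial_function (\<lambda>x. h (f x))"
  using polynomial_function_compose[OF _ polynomial_function_bounded_linear, of f h] by (simp add: o_def)

text \<open>
  Symmetric matrices of rank at most \<open>card K\<close> are parametrized by \<open>X\<^sup>T (M + M\<^sup>T) X\<close>.
  If some \<open>\<Omega>\<close> is annihilated by \<open>X\<close>, then the image of the derivative at \<open>(X, M)\<close> is
  orthogonal to it.
\<close>

lemma injective_if_zariski_dense:
  fixes E :: "'n::finite set set"
  assumes dense: "zariski_dense_in (graph_projection E ` {\<Omega> \<in> symmetric_matrices. rank \<Omega> = card K})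
      (graph_matrices E)"
  obtains X where "injective_on_graph E (keep_rows K X)"
proof (rule ccontr)
  note prem = that
  let ?S = "graph_matrices E"
  assume "\<not> thesis"
  then have "\<forall>X. \<exists>\<Omega>\<in>?S. keep_rows K X ** \<Omega> = 0 \<and> \<Omega> \<noteq> 0"
    using prem unfolding injective_on_graph_def by blast
  then obtain W where W: "\<And>X. W X \<in> ?S" "\<And>X. keep_rows K X ** W X = 0" "\<And>X. W X \<noteq> 0"
    by metis
  define R where "R q = keep_rows K (fst q)" for q :: "(real^'n^'n) \<times> (real^'n^'n)"
  \<comment> \<open>A free symmetric middle factor reaches matrices of every signature, while Gram
    matrices alone are positive semidefinite. Symmetrizing inside keeps the parameter space a full
    Euclidean space.\<close>
  define N where "N q = snd q + transpose (snd q)" for q :: "(real^'n^'n) \<times> (real^'n^'n)"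
  have R: "bounded_linear R"
    unfolding R_def
    by (rule bounded_linear_compose[OF linear_keep_rows[unfolded linear_conv_bounded_linear] bounded_linear_fst])
  have N: "bounded_linear N"
    unfolding N_def
    by (intro bounded_linear_add bounded_linear_snd bounded_linear_compose[OF bounded_linear_transpose])
  have RT: "bounded_linear (\<lambda>q. transpose (R q))"
    by (rule bounded_linear_compose[OF bounded_linear_transpose R])
  have N_sym: "transpose (N q) = N q" for q
    by (simp add: N_def transpose_add add.commute)
  note mult = bounded_bilinear_matrix_mult
  have proj: "bounded_linear (graph_projection E)"
    using linear_graph_projection by (simp add: linear_conv_bounded_linear)
  define f where "f q = graph_projection E (transpose (R q) ** N q ** R q)" for q
  define f' where "f' q v = graph_projection E (transpose (R q) ** N q ** R v +
      (transpose (R q) ** N v + transpose (R v) ** N q) ** R q)" for q v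
  have f: "polynomial_function f"
    unfolding f_def
    by (intro polynomial_function_linear_comp[OF proj] polynomial_function_bilinear[OF mult]
        polynomial_function_bounded_linear R N RT)
  have der: "(f has_derivative f' q) (at q)" for q
    unfolding f_def f'_def
    by (intro bounded_linear.has_derivative[OF proj] bounded_bilinear.FDERIV[OF mult]
        bounded_linear_imp_has_derivative R N RT)
  have cont: "isCont (\<lambda>q. f' q v) q" for q v
    unfolding f'_def
    by (intro bounded_linear.isCont[OF proj] continuous_add bounded_bilinear.continuous[OF mult]
        linear_continuous_at R N RT continuous_const)
  have rank: "dim (range (f' q)) < dim ?S" for q
  proof -
    define \<Omega> where "\<Omega> = W (fst q)"
    have \<Omega>: "\<Omega> \<in> ?S" "R q ** \<Omega> = 0" "\<Omega> \<noteq> 0"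
      using W by (auto simp: \<Omega>_def R_def)
    have "\<Omega> ** transpose (R q) = transpose (R q ** \<Omega>)"
      using graph_matrices_transpose[OF \<Omega>(1)] by (simp add: matrix_transpose_mul)
    then have \<Omega>R: "\<Omega> ** transpose (R q) = 0"
      by (simp add: \<Omega>(2) transpose_def vec_eq_iff)
    \<comment> \<open>Every summand of the derivative keeps a factor \<open>R q\<close> at its right
      end or its transpose at its left end, and either one is annihilated by
      \<open>\<Omega>\<close>.\<close>
    have "f' q v \<bullet> \<Omega> = 0" for v
    proof -
      have "(Z ** R q) \<bullet> \<Omega> = 0" for Z :: "real^'n^'n"
        by (simp add: inner_matrix_mult_right \<Omega>R)
      moreover have "(transpose (R q) ** Z) \<bullet> \<Omega> = 0" for Z :: "real^'n^'n"
        by (simp add: inner_matrix_mult_left \<Omega>(2))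
      ultimately show ?thesis
        unfolding f'_def inner_graph_projection[OF \<Omega>(1)] inner_add_left matrix_mul_assoc[symmetric]
        by simp
    qed
    moreover have "f' q v \<in> ?S" for v
      unfolding f'_def
      by (intro graph_projection_in)
         (simp add: transpose_add matrix_transpose_mul N_sym matrix_mult_add_left matrix_mult_add_right
           matrix_mul_assoc add_ac)
    ultimately have "range (f' q) \<subseteq> {y \<in> ?S. orthogonal \<Omega> y}"
      by (auto simp: orthogonal_def inner_commute)
    moreover have sub: "subspace {y \<in> ?S. orthogonal \<Omega> y}"
      using subspace_inter[OF subspace_graph_matrices subspace_orthogonal_to_vector[of \<Omega>]]
      by (simp add: Int_def)
    moreover have "\<Omega> \<notin> {y \<in> ?S. orthogonal \<Omega> y}"
      using \<Omega> by (simp add: orthogonal_self)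
    then have "{y \<in> ?S. orthogonal \<Omega> y} \<subset> ?S"
      using \<Omega>(1) by blast
    ultimately show ?thesis
      using dim_psubset[of "{y \<in> ?S. orthogonal \<Omega> y}" ?S] dim_subset[of "range (f' q)"]
      unfolding span_eq_iff[THEN iffD2, OF sub] span_eq_iff[THEN iffD2, OF subspace_graph_matrices]
      by (meson le_less_trans)
  qed
  obtain P y where P: "real_polynomial_function P" "y \<in> ?S" "P y \<noteq> 0" "\<And>q. P (f q) = 0"
    by (rule algebraic_dependence_by_rank[OF f subspace_graph_matrices der cont rank]) blast
  have "P (graph_projection E A) = 0" if A: "transpose A = A" "rank A = card K" for A
  proof -
    have range: "subspace (range ((*v) A))"
      by (intro linear_subspace_image subspace_UNIV matrix_vector_mul_linear)
    obtain B where B: "B \<subseteq> range ((*v) A)" "pairwise orthogonal B" "\<And>x. x \<in> B \<Longrightarrow> norm x = 1"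
        "independent B" "card B = dim (range ((*v) A))" "span B = range ((*v) A)"
      using orthonormal_basis_subspace[OF range] by metis
    have "finite B"
      using B(4) by (rule independent_imp_finite)
    moreover have "card K = card B"
      using A(2) B(5) by (simp add: rank_dim_range)
    ultimately obtain \<phi> where \<phi>: "bij_betw \<phi> K B"
      using finite_same_card_bij[of K B] by auto
    \<comment> \<open>The rows in \<open>K\<close> are an orthonormal basis of the range of
      \<open>A\<close>, so \<open>transpose X ** X\<close> is the orthogonal projection onto this
      range and fixes \<open>A\<close> from both sides.\<close>
    define X where "X = keep_rows K (\<chi> k. \<phi> k)"
    have fix_range: "transpose X *v (X *v y) = y" if "y \<in> range ((*v) A)" for y
    proof -
      have "y = (\<Sum>b\<in>B. (b \<bullet> y) *\<^sub>R b)"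
        using orthonormal_basis_expand[OF B(2,3) _ \<open>finite B\<close>, of y] that B(6) by (simp add: inner_commute)
      also have "\<dots> = (\<Sum>k\<in>K. (\<phi> k \<bullet> y) *\<^sub>R \<phi> k)"
        by (rule sum.reindex_bij_betw[OF \<phi>, symmetric])
      also have "\<dots> = transpose X *v (X *v y)"
      proof -
        have "(X *v y) $ k = (if k \<in> K then \<phi> k \<bullet> y else 0)" for k
          by (simp add: X_def keep_rows_def matrix_vector_mult_def inner_vec_def)
        moreover have "(transpose X *v z) $ i = (\<Sum>k\<in>UNIV. X $ k $ i * z $ k)" for z i
          by (simp add: matrix_vector_mult_def transpose_def del: transpose_matrix_vector)
        ultimately have "(transpose X *v (X *v y)) $ i = (\<Sum>k\<in>K. (\<phi> k \<bullet> y) * \<phi> k $ i)" for i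
          by (simp only:) (intro sum.mono_neutral_cong_right, auto simp: X_def keep_rows_def)
        then show ?thesis
          by (simp add: vec_eq_iff sum_component del: transpose_matrix_vector)
      qed
      finally show ?thesis ..
    qed
    define Q where "Q = transpose X ** X"
    have "Q ** A = A"
      unfolding matrix_eq Q_def
      by (simp add: matrix_vector_mul_assoc[symmetric] fix_range del: transpose_matrix_vector)
    moreover have "A ** Q = A"
    proof -
      have "transpose (Q ** A) = A"
        using \<open>Q ** A = A\<close> A(1) by simp
      then show ?thesis
        by (simp add: matrix_transpose_mul A(1) Q_def)
    qed
    ultimately have "A = Q ** A ** Q"
      by simp
    \<comment> \<open>The factor 1/2 compensates the symmetrization, since
      \<open>X ** A ** transpose X\<close> is already symmetric.\<close>
    define M where "M = (1/2) *\<^sub>R (X ** A ** transpose X)"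
    have "M + transpose M = X ** A ** transpose X"
      by (simp add: M_def transpose_scaleR matrix_transpose_mul A(1) matrix_mul_assoc
          scaleR_2[symmetric])
    then have "f (X, M) = graph_projection E (transpose X ** (X ** A ** transpose X) ** X)"
      by (simp add: f_def R_def N_def X_def keep_rows_idem)
    also have "transpose X ** (X ** A ** transpose X) ** X = A"
      using \<open>A = Q ** A ** Q\<close> by (simp add: Q_def matrix_mul_assoc)
    finally show ?thesis
      using P(4)[of "(X, M)"] by simp
  qed
  then have "\<forall>x\<in>?S. P x = 0"
    using dense P(1) by (auto simp: zariski_dense_in_def symmetric_matrices_def)
  then show False
    using P(2,3) by blast
qed

lemma pos_semidef_gram: "pos_semidef (gram r X)"
proof -
  have "x \<bullet> (gram r X *v x) = (\<Sum>k<r. (\<Sum>i\<in>UNIV. X (k, i) * x $ i)\<^sup>2)" for x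
  proof -
    have "x \<bullet> (gram r X *v x) = (\<Sum>i\<in>UNIV. \<Sum>j\<in>UNIV. \<Sum>k<r. (X (k, i) * x $ i) * (X (k, j) * x $ j))"
      by (simp add: inner_vec_def matrix_vector_mult_def gram_def sum_distrib_left sum_distrib_right mult_ac)
    also have "\<dots> = (\<Sum>i\<in>UNIV. \<Sum>k<r. \<Sum>j\<in>UNIV. (X (k, i) * x $ i) * (X (k, j) * x $ j))"
      by (intro sum.cong sum.swap refl)
    also have "\<dots> = (\<Sum>k<r. \<Sum>i\<in>UNIV. \<Sum>j\<in>UNIV. (X (k, i) * x $ i) * (X (k, j) * x $ j))"
      by (rule sum.swap)
    also have "\<dots> = (\<Sum>k<r. (\<Sum>i\<in>UNIV. X (k, i) * x $ i)\<^sup>2)"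
      by (simp add: power2_eq_square sum_product)
    finally show ?thesis .
  qed
  then show ?thesis
    by (simp add: pos_semidef_def symmetric_matrices_def transpose_def gram_def vec_eq_iff
        mult.commute sum_nonneg)
qed

lemma AE_unique_minimizer:
  fixes E :: "'n::finite set set"
  assumes K: "card K \<le> r" and X: "injective_on_graph E (keep_rows K X)"
  shows "AE X in lebesgue_rows r. unique_minimizer E (gram r X)"
proof -
  obtain \<phi> where \<phi>: "bij_betw \<phi> {..<card K} K"
    using ex_bij_betw_nat_finite[of K] by (auto simp: atLeast0LessThan)
  \<comment> \<open>Lists the rows in \<open>K\<close> first and fills up with zero rows to
    \<open>r\<close> rows.\<close>
  define X0 where "X0 = (\<lambda>(k, i). if k < card K then X $ \<phi> k $ i else 0)"
  have "gram r X0 = transpose (keep_rows K X) ** keep_rows K X"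
  proof -
    have "(\<Sum>k<r. X0 (k, i) * X0 (k, j)) = (\<Sum>k\<in>UNIV. keep_rows K X $ k $ i * keep_rows K X $ k $ j)" for i j
    proof -
      have "(\<Sum>k<r. X0 (k, i) * X0 (k, j)) = (\<Sum>k<card K. X $ \<phi> k $ i * X $ \<phi> k $ j)"
        using K by (intro sum.mono_neutral_cong_right) (auto simp: X0_def)
      also have "\<dots> = (\<Sum>k\<in>K. X $ k $ i * X $ k $ j)"
        by (rule sum.reindex_bij_betw[OF \<phi>])
      also have "\<dots> = (\<Sum>k\<in>UNIV. keep_rows K X $ k $ i * keep_rows K X $ k $ j)"
        by (intro sum.mono_neutral_cong_left) (auto simp: keep_rows_def)
      finally show ?thesis .
    qed
    then show ?thesis
      by (simp add: gram_def vec_eq_iff matrix_matrix_mult_def transpose_def)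
  qed
  moreover have "injective_on_graph E (transpose Y ** Y)" if "injective_on_graph E Y" for Y
    unfolding injective_on_graph_def
  proof (intro ballI impI)
    fix \<Omega> assume \<Omega>: "\<Omega> \<in> graph_matrices E" "transpose Y ** Y ** \<Omega> = 0"
    have "(Y ** \<Omega>) \<bullet> (Y ** \<Omega>) = \<Omega> \<bullet> (transpose Y ** Y ** \<Omega>)"
      by (simp add: inner_matrix_mult_left matrix_mul_assoc)
    then have "Y ** \<Omega> = 0"
      using \<Omega>(2) by simp
    then show "\<Omega> = 0"
      using that \<Omega>(1) by (simp add: injective_on_graph_def)
  qed
  ultimately have "injective_on_graph E (gram r X0)"
    using X by simp
  from AE_injective_on_graph[OF this] show ?thesis
  proof eventually_elim
    case (elim X)
    then show ?case
      by (intro unique_minimizer_if_injective pos_semidef_gram) (simp add: injective_on_graph_def)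
  qed
qed

theorem theorem1:
  fixes E :: "'n::finite set set"
  assumes "simple_graph E"
  shows "weak_pl_rank E \<le> generic_completion_rank E \<and>
         generic_completion_rank E \<le> degeneracy E + 1 \<and>
         strong_pl_rank E \<le> degeneracy E + 1"
proof (intro conjI)
  show "strong_pl_rank E \<le> degeneracy E + 1"
    using assms by (rule strong_pl_rank_le)
  show le: "generic_completion_rank E \<le> degeneracy E + 1"
    using assms by (rule generic_completion_rank_le)
  \<comment> \<open>Rows are indexed by vertices, so a set \<open>K\<close> of this size must fit
    into the vertex type.\<close>
  have "generic_completion_rank E \<le> CARD('n)"
    using le degeneracy_less_card[OF assms] by linarith
  then obtain K :: "'n set" where K: "card K = generic_completion_rank E"
    using obtain_subset_with_card_n by metis
  obtain X where "injective_on_graph E (keep_rows K X)"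
    using injective_if_zariski_dense[of E K] zariski_dense_generic_completion_rank[OF assms]
    unfolding K by blast
  then show "weak_pl_rank E \<le> generic_completion_rank E"
    unfolding weak_pl_rank_def
    by (intro Least_le allI impI AE_unique_minimizer) (simp_all add: K)
qed

end
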